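(* Let $a_*\in\left(\frac{5204}{10000},\frac{5244}{10000}\right)$ and $t_*\in\left(\frac{3966}{10000},\frac{3991}{10000}\right)$ be real numbers such that the solution $(r(t),\theta(t),\alpha(t))$ of \[ \dot r = \cos\alpha,\qquad \dot\theta = \frac{\sin\alpha}{\sin r},\qquad \dot\alpha = \frac{2\cot(2\theta)}{\sin r}\,\cos\alpha - 3\cot r\,\sin\alpha - 3, \] with $r(0)=\frac{\pi}{2}$, $\theta(0)=a_*$, $\alpha(0)=\pi$, is defined on $\left[0,\frac{3991}{10000}\right]$ and satisfies $\alpha(t_* )=\frac{\pi}{2}$ and $\theta(t_* )=\frac{\pi}{4}$. Let $(r,\theta,\alpha)$ also denote its maximal extension, which is defined on $[0,4t_*]$. Then \[ M=\left\{\bigl(\sin r(t)\cos\theta(t)\,y,\ \sin r(t)\sin\theta(t)\,z,\ \cos r(t)\bigr)\ :\ t\in[0,4t_*],\ y,z\in \mathbf{S}^1\right\} \] is an embedded hypersurface in the unit sphere $\mathbf{S}^4$ with constant mean curvature $H=-3$.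
   Context: $\mathbf{S}^1\subset\mathbb{R}^2$ and $\mathbf{S}^4\subset\mathbb{R}^5=\mathbb{R}^2\times\mathbb{R}^2\times\mathbb{R}$ are the unit spheres, $\mathbf{S}^4$ carrying its standard round metric. A hypersurface of $\mathbf{S}^4$ is a smooth $3$-dimensional submanifold. Its mean curvature $H$ is the sum of its three principal curvatures (the trace of the shape operator, not divided by $3$) with respect to a suitable choice of unit normal vector field along $M$ in $\mathbf{S}^4$. Numbers $a_*,t_*$ with the stated properties exist. By the symmetries of the differential equation, the solution extends to all $t\in\mathbb{R}$, in particular to $[0,4t_*]$, and the profile curve $\beta(t)=\bigl(\sin r(t)\cos\theta(t),\sin r(t)\sin\theta(t),\cos r(t)\bigr)$ is a smooth closed curve in $\mathbf{S}^2$ with $\beta(0)=\beta(4t_* )$ and $\beta'(0)=\beta'(4t_* )$. *)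

theory Defs
  imports "HOL-Analysis.Analysis"
begin

subsection \<open>Smooth maps\<close>

primrec Ck_on :: "nat \<Rightarrow> ('a::euclidean_space \<Rightarrow> 'b::real_normed_vector) \<Rightarrow> 'a set \<Rightarrow> bool" where
  "Ck_on 0 f S \<longleftrightarrow> continuous_on S f"
| "Ck_on (Suc k) f S \<longleftrightarrow>
     (\<forall>x\<in>S. f differentiable (at x)) \<and>
     (\<forall>v. Ck_on k (\<lambda>x. frechet_derivative f (at x) v) S)"

text \<open>To be used for open \<open>S\<close> only, since the derivatives are unrestricted.\<close>

definition smooth_on :: "'a::euclidean_space set \<Rightarrow> ('a \<Rightarrow> 'b::real_normed_vector) \<Rightarrow> bool" where
  "smooth_on S f \<longleftrightarrow> (\<forall>k. Ck_on k f S)"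

definition smooth_along ::
    "'a::euclidean_space set \<Rightarrow> ('a \<Rightarrow> 'b::real_normed_vector) \<Rightarrow> bool" where
  "smooth_along M f \<longleftrightarrow>
     (\<forall>p\<in>M. \<exists>W F. open W \<and> p \<in> W \<and> smooth_on W F \<and> (\<forall>q\<in>M \<inter> W. F q = f q))"

subsection \<open>Hypersurfaces of the unit sphere\<close>

text \<open>The product norm on this type is the Euclidean norm of \<open>\<real>\<^sup>5\<close>, so that
  \<open>sphere 0 1\<close> is the round \<open>\<^bold>S\<^sup>4\<close>.\<close>

type_synonym R5 = "(real ^ 2) \<times> (real ^ 2) \<times> real"

definition local_parametrization ::
    "'b::euclidean_space set \<Rightarrow> 'b \<Rightarrow> 'a::euclidean_space set \<Rightarrow> ('a \<Rightarrow> 'b) \<Rightarrow> bool" where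
  "local_parametrization M p U \<phi> \<longleftrightarrow>
     open U \<and> smooth_on U \<phi> \<and> (\<forall>u\<in>U. inj (frechet_derivative \<phi> (at u))) \<and>
     (\<exists>W \<psi>. open W \<and> p \<in> W \<and> homeomorphism U (M \<inter> W) \<phi> \<psi>)"

text \<open>The neighbourhood \<open>W\<close> above is open in the ambient space, so the following are
  embedded and not merely immersed submanifolds.\<close>

definition embedded_hypersurface :: "R5 set \<Rightarrow> bool" where
  "embedded_hypersurface M \<longleftrightarrow>
     M \<subseteq> sphere 0 1 \<and>
     (\<forall>p\<in>M. \<exists>(U :: (real ^ 3) set) \<phi>. local_parametrization M p U \<phi>)"

definition tangent_space :: "'a::euclidean_space set \<Rightarrow> 'a \<Rightarrow> 'a set" where
  "tangent_space M p =
     {v. \<exists>\<epsilon>>0. \<exists>c :: real \<Rightarrow> 'a. smooth_on {-\<epsilon><..<\<epsilon>} c \<and> c ` {-\<epsilon><..<\<epsilon>} \<subseteq> M \<and>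
           c 0 = p \<and> (c has_vector_derivative v) (at 0)}"

definition unit_normal_field :: "R5 set \<Rightarrow> (R5 \<Rightarrow> R5) \<Rightarrow> bool" where
  "unit_normal_field M N \<longleftrightarrow>
     smooth_along M N \<and>
     (\<forall>p\<in>M. norm (N p) = 1 \<and> N p \<in> tangent_space (sphere 0 1) p \<and>
            (\<forall>v\<in>tangent_space M p. N p \<bullet> v = 0))"

text \<open>The Levi-Civita derivative of \<open>\<^bold>S\<^sup>4\<close> is the projection of the flat derivative to the
  tangent space of the sphere at \<open>p\<close>. The derivative of \<open>N\<close> within \<open>M\<close> is only determined
  on vectors tangent to \<open>M\<close>, and \<open>shape_operator M N p\<close> is meaningful on those alone.\<close>

definition shape_operator :: "R5 set \<Rightarrow> (R5 \<Rightarrow> R5) \<Rightarrow> R5 \<Rightarrow> R5 \<Rightarrow> R5" where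
  "shape_operator M N p v =
     (let D = frechet_derivative N (at p within M) v in - (D - (D \<bullet> p) *\<^sub>R p))"

definition orthonormal_basis :: "'a::euclidean_space set \<Rightarrow> 'a set \<Rightarrow> bool" where
  "orthonormal_basis V B \<longleftrightarrow> pairwise orthogonal B \<and> (\<forall>b\<in>B. norm b = 1) \<and> span B = V"

definition trace_on :: "'a::euclidean_space set \<Rightarrow> ('a \<Rightarrow> 'a) \<Rightarrow> real" where
  "trace_on V A = (\<Sum>b\<in>(SOME B. orthonormal_basis V B). A b \<bullet> b)"

lemma trace_on_eq:
  fixes A :: "'a::euclidean_space \<Rightarrow> 'a"
  assumes "linear A" and B: "orthonormal_basis V B"
  shows "trace_on V A = (\<Sum>b\<in>B. A b \<bullet> b)"
proof -
  define C where "C = (SOME B. orthonormal_basis V B)"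
  have C: "orthonormal_basis V C"
    unfolding C_def using B by (rule someI)
  have fin: "finite D" if "orthonormal_basis V D" for D
    using that unfolding orthonormal_basis_def by (intro pairwise_orthogonal_imp_finite) auto
  have expand: "x = (\<Sum>d\<in>D. (x \<bullet> d) *\<^sub>R d)" if D: "orthonormal_basis V D" and "x \<in> V" for x D
  proof -
    have eq: "(\<Sum>d\<in>D. ((x \<bullet> d) / (d \<bullet> d)) *\<^sub>R d) = (\<Sum>d\<in>D. (x \<bullet> d) *\<^sub>R d)"
      using D by (intro sum.cong) (auto simp: orthonormal_basis_def dot_square_norm)
    let ?y = "x - (\<Sum>d\<in>D. (x \<bullet> d) *\<^sub>R d)"
    have "orthogonal z ?y" if "z \<in> span D" for z
      using Gram_Schmidt_step[OF _ that, of x] D eq unfolding orthonormal_basis_def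
      by (simp add: inner_commute)
    moreover have "?y \<in> span D"
      using D \<open>x \<in> V\<close> unfolding orthonormal_basis_def
      by (intro span_diff span_sum span_scale) (auto intro: span_base)
    ultimately have "orthogonal ?y ?y"
      by blast
    then show ?thesis
      by (simp add: orthogonal_self)
  qed
  have V: "D \<subseteq> V" if "orthonormal_basis V D" for D
    using that span_superset unfolding orthonormal_basis_def by blast
  have "(\<Sum>b\<in>B. A b \<bullet> b) = (\<Sum>b\<in>B. \<Sum>c\<in>C. (b \<bullet> c) * (A c \<bullet> b))"
  proof (intro sum.cong refl)
    fix b assume "b \<in> B"
    then have "b = (\<Sum>c\<in>C. (b \<bullet> c) *\<^sub>R c)"
      using expand[OF C] V[OF B] by blast
    then have "A b = A (\<Sum>c\<in>C. (b \<bullet> c) *\<^sub>R c)"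
      by (rule arg_cong)
    also have "\<dots> = (\<Sum>c\<in>C. (b \<bullet> c) *\<^sub>R A c)"
      by (simp only: linear_sum[OF \<open>linear A\<close>] linear_scale[OF \<open>linear A\<close>])
    finally show "A b \<bullet> b = (\<Sum>c\<in>C. (b \<bullet> c) * (A c \<bullet> b))"
      by (simp add: inner_sum_left)
  qed
  also have "\<dots> = (\<Sum>c\<in>C. \<Sum>b\<in>B. (b \<bullet> c) * (A c \<bullet> b))"
    by (rule sum.swap)
  also have "\<dots> = (\<Sum>c\<in>C. A c \<bullet> c)"
  proof (intro sum.cong refl)
    fix c assume "c \<in> C"
    then have "c = (\<Sum>b\<in>B. (c \<bullet> b) *\<^sub>R b)"
      using expand[OF B] V[OF C] by blast
    then have "A c \<bullet> c = A c \<bullet> (\<Sum>b\<in>B. (c \<bullet> b) *\<^sub>R b)"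
      by (rule arg_cong)
    then show "(\<Sum>b\<in>B. (b \<bullet> c) * (A c \<bullet> b)) = A c \<bullet> c"
      by (simp add: inner_sum_right inner_commute)
  qed
  finally show ?thesis
    unfolding trace_on_def C_def by simp
qed

text \<open>The trace is not divided by the dimension.\<close>

definition mean_curvature :: "R5 set \<Rightarrow> (R5 \<Rightarrow> R5) \<Rightarrow> R5 \<Rightarrow> real" where
  "mean_curvature M N p = trace_on (tangent_space M p) (shape_operator M N p)"

subsection \<open>The profile equations\<close>

text \<open>In HOL division by zero yields zero, so the two inequations are needed to confine a
  solution to the domain where the right-hand sides are defined. The derivatives are
  one-sided at endpoints belonging to \<open>J\<close>.\<close>

definition profile_solution ::
    "real \<Rightarrow> real set \<Rightarrow> (real \<Rightarrow> real) \<Rightarrow> (real \<Rightarrow> real) \<Rightarrow> (real \<Rightarrow> real) \<Rightarrow> bool" where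
  "profile_solution a J r \<theta> \<alpha> \<longleftrightarrow>
     is_interval J \<and> 0 \<in> J \<and> r 0 = pi / 2 \<and> \<theta> 0 = a \<and> \<alpha> 0 = pi \<and>
     (\<forall>s\<in>J. sin (r s) \<noteq> 0 \<and> sin (2 * \<theta> s) \<noteq> 0 \<and>
        (r has_real_derivative cos (\<alpha> s)) (at s within J) \<and>
        (\<theta> has_real_derivative sin (\<alpha> s) / sin (r s)) (at s within J) \<and>
        (\<alpha> has_real_derivative
           2 * cot (2 * \<theta> s) / sin (r s) * cos (\<alpha> s) - 3 * cot (r s) * sin (\<alpha> s) - 3)
          (at s within J))"

definition maximal_profile_solution ::
    "real \<Rightarrow> real set \<Rightarrow> (real \<Rightarrow> real) \<Rightarrow> (real \<Rightarrow> real) \<Rightarrow> (real \<Rightarrow> real) \<Rightarrow> bool" where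
  "maximal_profile_solution a J r \<theta> \<alpha> \<longleftrightarrow>
     profile_solution a J r \<theta> \<alpha> \<and>
     (\<forall>J' r' \<theta>' \<alpha>'. profile_solution a J' r' \<theta>' \<alpha>' \<and> J \<subseteq> J' \<and>
        (\<forall>s\<in>J. r' s = r s \<and> \<theta>' s = \<theta> s \<and> \<alpha>' s = \<alpha> s) \<longrightarrow> J' = J)"

end

theory Submission
  imports Defs
begin

text \<open>
  The group \<open>O(2) \<times> O(2)\<close> acts on the two planes of the ambient space and preserves \<open>M\<close>, which is
  swept out by the curve \<open>(X, Y, Z) = (sin r cos \<theta>, sin r sin \<theta>, cos r)\<close> of the round \<open>2\<close>-sphere.
  This curve has unit speed, and \<open>\<alpha>\<close> is the angle from the direction of increasing \<open>r\<close> to its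
  velocity. Let \<open>n\<close> be its unit normal and \<open>\<kappa>\<close> its geodesic curvature. In the orthonormal frame that
  consists of the velocity of the curve and of the two circle directions, the shape operator of \<open>M\<close>
  is diagonal with entries \<open>\<kappa>\<close>, \<open>- n1 / X\<close> and \<open>- n2 / Y\<close> (\<open>mean_curvature_hypersurface\<close>), and the
  equation for \<open>\<alpha>\<close> says that their sum is \<open>- 3\<close> (\<open>profile_mean_curvature\<close>). What has to be shown is
  therefore that the curve is smooth, closed, simple, and stays in the region \<open>X > 0\<close>, \<open>Y > 0\<close>.

  It closes up because of two symmetries of the equations, both reversing time: the reflection
  \<open>r \<mapsto> pi - r\<close> about the time \<open>0\<close>, when the curve crosses the equator orthogonally, and the reflection
  \<open>\<theta> \<mapsto> pi / 2 - \<theta>\<close> about the time \<open>t\<close>, when it crosses the meridian \<open>\<theta> = pi / 4\<close> orthogonally. Solutions are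
  unique, so the solution agrees with its two reflected copies wherever both are defined, and
  maximality makes its domain invariant under \<open>s \<mapsto> - s\<close> and \<open>s \<mapsto> 2 t - s\<close>
  (\<open>maximal_profile_solution_symmetric\<close>). An interval with this property is the whole line, and
  the square of the composition of the two reflections is the translation by the period \<open>4 t\<close>.

  It is simple because the arc over \<open>[0, t]\<close> is monotone. While \<open>\<theta>\<close> remains between \<open>0.5\<close> and
  \<open>0.96\<close> and the time is at most \<open>0.4\<close>, the derivative of \<open>\<alpha>\<close> differs from \<open>- 3\<close> by at most \<open>2.9\<close>
  (\<open>turning_bounds\<close>); hence \<open>\<alpha>\<close> decreases, but remains positive, and this in turn confines \<open>\<theta>\<close> to
  that range (\<open>\<theta>_bounds\<close>). Thus \<open>\<alpha>\<close> decreases from \<open>pi\<close> to \<open>pi / 2\<close> on \<open>[0, t]\<close>, where \<open>r\<close> decreases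
  and \<open>\<theta>\<close> increases to \<open>pi / 4\<close>. With the reflections, \<open>r\<close> is injective on \<open>[- t, t]\<close>, where
  \<open>\<theta> \<le> pi / 4\<close>, and on \<open>[t, 3 t]\<close>, where \<open>\<theta> \<ge> pi / 4\<close> (\<open>profile_curve_simple\<close>).

  A simple closed curve of this kind sweeps out an embedded hypersurface by compactness
  (\<open>\<Phi>_open_embedding\<close>). Its unit normal extends smoothly to the ambient space, because near a given
  point the parameter of the curve is a smooth function of \<open>|P|\<close>, \<open>|Q|\<close> and \<open>c\<close> at \<open>(P, Q, c)\<close>
  (\<open>parameter_extends_smoothly\<close>).
\<close>

section \<open>Smooth functions\<close>

text \<open>
  Openness is essential: the derivatives that define \<open>Ck_on\<close> are unrestricted, so they see a
  neighbourhood of each point.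
\<close>

lemma Ck_on_cong:
  assumes "open S" "\<And>x. x \<in> S \<Longrightarrow> f x = g x" "Ck_on k f S"
  shows "Ck_on k g S"
  using assms(2,3)
proof (induction k arbitrary: f g)
  case 0
  then show ?case by (simp cong: continuous_on_cong)
next
  case (Suc k)
  have D: "(g has_derivative frechet_derivative f (at x)) (at x)" if "x \<in> S" for x
    using Suc.prems that assms(1)
    by (auto intro: has_derivative_transform_within_open simp: frechet_derivative_works)
  then have eq: "frechet_derivative g (at x) = frechet_derivative f (at x)" if "x \<in> S" for x
    using that frechet_derivative_at by metis
  show ?case
  proof (simp, intro conjI ballI allI)
    show "g differentiable at x" if "x \<in> S" for x using D[OF that] by (auto simp: differentiable_def)
    show "Ck_on k (\<lambda>x. frechet_derivative g (at x) v) S" for v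
    proof (rule Suc.IH)
      show "frechet_derivative f (at x) v = frechet_derivative g (at x) v" if "x \<in> S" for x
        by (simp only: eq[OF that])
      show "Ck_on k (\<lambda>x. frechet_derivative f (at x) v) S"
        using Suc.prems(2) by simp
    qed
  qed
qed

text \<open>
  For derivatives in closed form, in place of the choice operator inside \<open>frechet_derivative\<close>.
\<close>

lemma Ck_on_SucI:
  assumes "open S" "\<And>x. x \<in> S \<Longrightarrow> (f has_derivative f' x) (at x)"
    and "\<And>v. Ck_on k (\<lambda>x. f' x v) S"
  shows "Ck_on (Suc k) f S"
proof (simp, intro conjI ballI allI)
  show "f differentiable at x" if "x \<in> S" for x using assms(2)[OF that] by (auto simp: differentiable_def)
  show "Ck_on k (\<lambda>x. frechet_derivative f (at x) v) S" for v
    using assms by (intro Ck_on_cong[OF assms(1) _ assms(3)[of v]]) (metis frechet_derivative_at)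
qed

lemma Ck_on_Suc_has_derivative:
  "Ck_on (Suc k) f S \<Longrightarrow> x \<in> S \<Longrightarrow> (f has_derivative frechet_derivative f (at x)) (at x)"
  by (simp add: frechet_derivative_works)

lemma Ck_on_Suc_derivative: "Ck_on (Suc k) f S \<Longrightarrow> Ck_on k (\<lambda>x. frechet_derivative f (at x) v) S"
  by simp

lemma Ck_on_Suc_imp: "Ck_on (Suc k) f S \<Longrightarrow> Ck_on k f S"
proof (induction k arbitrary: f)
  case 0
  then show ?case
    by (auto simp: differentiable_imp_continuous_within continuous_at_imp_continuous_on)
qed auto

lemma Ck_on_subset: "Ck_on k f S \<Longrightarrow> T \<subseteq> S \<Longrightarrow> Ck_on k f T"
  by (induction k arbitrary: f) (auto intro: continuous_on_subset)

lemma Ck_on_const: "Ck_on k (\<lambda>x. c) S"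
  by (induction k arbitrary: c) auto

lemma Ck_on_bounded_linear:
  assumes "bounded_linear f" "open S" shows "Ck_on k f S"
proof (cases k)
  case 0
  then show ?thesis using assms(1) by (simp add: linear_continuous_on)
next
  case (Suc j)
  then show ?thesis
    using assms Ck_on_SucI[OF assms(2), of f "\<lambda>x. f"]
    by (auto intro: bounded_linear_imp_has_derivative Ck_on_const)
qed

lemma Ck_on_add:
  assumes "open S" "Ck_on k f S" "Ck_on k g S" shows "Ck_on k (\<lambda>x. f x + g x) S"
  using assms(2,3)
proof (induction k arbitrary: f g)
  case 0
  then show ?case by (auto intro!: continuous_intros)
next
  case (Suc k)
  note f = Suc.prems(1) and g = Suc.prems(2)
  show ?case
    by (rule Ck_on_SucI[OF assms(1) has_derivative_add[OF Ck_on_Suc_has_derivative[OF f] Ck_on_Suc_has_derivative[OF g]]])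
       (assumption | intro Suc.IH Ck_on_Suc_derivative[OF f] Ck_on_Suc_derivative[OF g])+
qed

text \<open>
  The product rule expresses the derivative by products of one order less, so the induction runs
  over all pairs of functions at once.
\<close>

lemma Ck_on_scaleR:
  fixes f :: "'a::euclidean_space \<Rightarrow> real"
  assumes "open S" "Ck_on k f S" "Ck_on k g S" shows "Ck_on k (\<lambda>x. f x *\<^sub>R g x) S"
  using assms(2,3)
proof (induction k arbitrary: f g)
  case 0
  then show ?case by (auto intro!: continuous_intros)
next
  case (Suc k)
  note f = Suc.prems(1) and g = Suc.prems(2)
  show ?case
  proof (rule Ck_on_SucI[OF assms(1)])
    show "((\<lambda>x. f x *\<^sub>R g x) has_derivative
        (\<lambda>v. f x *\<^sub>R frechet_derivative g (at x) v + frechet_derivative f (at x) v *\<^sub>R g x)) (at x)"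
      if "x \<in> S" for x
      by (rule has_derivative_scaleR[OF Ck_on_Suc_has_derivative[OF f that] Ck_on_Suc_has_derivative[OF g that]])
    show "Ck_on k (\<lambda>x. f x *\<^sub>R frechet_derivative g (at x) v + frechet_derivative f (at x) v *\<^sub>R g x) S" for v
      by (intro Ck_on_add assms(1) Suc.IH Ck_on_Suc_derivative[OF f] Ck_on_Suc_derivative[OF g]
            Ck_on_Suc_imp[OF f] Ck_on_Suc_imp[OF g])
  qed
qed

text \<open>
  Since the inner function is real-valued, the outer derivative is determined by its value at \<open>1\<close>, and
  the chain rule becomes a product to which \<open>Ck_on_scaleR\<close> applies.
\<close>

lemma Ck_on_compose:
  fixes f :: "'a::euclidean_space \<Rightarrow> real"
  assumes "open S" "f ` S \<subseteq> T" "Ck_on k f S" "Ck_on k g T" shows "Ck_on k (\<lambda>x. g (f x)) S"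
  using assms(3,4)
proof (induction k arbitrary: g)
  case 0
  then show ?case using assms(2) by (auto intro: continuous_on_compose2)
next
  case (Suc k)
  have D: "((\<lambda>x. g (f x)) has_derivative
      (\<lambda>v. frechet_derivative f (at x) v *\<^sub>R frechet_derivative g (at (f x)) 1)) (at x)" if "x \<in> S" for x
  proof -
    have g: "(g has_derivative frechet_derivative g (at (f x))) (at (f x))"
      using Suc.prems(2) that assms(2) by (intro Ck_on_Suc_has_derivative) auto
    have "frechet_derivative g (at (f x)) = (\<lambda>v. v *\<^sub>R frechet_derivative g (at (f x)) 1)"
    proof
      show "frechet_derivative g (at (f x)) v = v *\<^sub>R frechet_derivative g (at (f x)) 1" for v
        using linear_scale[OF has_derivative_linear[OF g], of v 1] by simp
    qed
    then have "(g has_derivative (\<lambda>v. v *\<^sub>R frechet_derivative g (at (f x)) 1)) (at (f x))"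
      using g by metis
    then show ?thesis
      by (rule has_derivative_compose[OF Ck_on_Suc_has_derivative[OF Suc.prems(1) that]])
  qed
  show ?case
    by (intro Ck_on_SucI[OF assms(1) D] Ck_on_scaleR[OF assms(1)] Ck_on_Suc_derivative[OF Suc.prems(1)]
         Suc.IH Ck_on_Suc_derivative[OF Suc.prems(2)] Ck_on_Suc_imp[OF Suc.prems(1)])
qed

lemma Ck_on_SucI_real:
  fixes f :: "real \<Rightarrow> real"
  assumes "open S" "\<And>x. x \<in> S \<Longrightarrow> (f has_real_derivative f' x) (at x)" "Ck_on k f' S"
  shows "Ck_on (Suc k) f S"
proof (rule Ck_on_SucI[OF assms(1)])
  show "(f has_derivative (\<lambda>v. f' x * v)) (at x)" if "x \<in> S" for x
    using assms(2)[OF that] by (simp add: has_field_derivative_def)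
  show "Ck_on k (\<lambda>x. f' x * v) S" for v
    using Ck_on_scaleR[OF assms(1,3) Ck_on_const[of k v]] by simp
qed

text \<open>
  Bootstrapping for an autonomous equation: if \<open>f' = G \<circ> f\<close>, each degree of regularity of \<open>f\<close> yields
  the next. This covers the inverse, the square root and local inverse functions, whose
  derivatives are simple functions of themselves.
\<close>

lemma smooth_on_deriv_chain:
  fixes f :: "real \<Rightarrow> real"
  assumes "open S" "\<And>x. x \<in> S \<Longrightarrow> (f has_real_derivative G (f x)) (at x)"
    and "\<And>k. Ck_on k f S \<Longrightarrow> Ck_on k (\<lambda>x. G (f x)) S"
  shows "smooth_on S f"
  unfolding smooth_on_def
proof
  show "Ck_on k f S" for k
  proof (induction k)
    case 0
    show ?case using assms(2) by (auto intro!: continuous_at_imp_continuous_on DERIV_isCont)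
  next
    case (Suc k)
    show ?case by (rule Ck_on_SucI_real[OF assms(1,2) assms(3)[OF Suc]])
  qed
qed

lemma Ck_on_mult:
  fixes f g :: "'a::euclidean_space \<Rightarrow> real"
  assumes "open S" "Ck_on k f S" "Ck_on k g S" shows "Ck_on k (\<lambda>x. f x * g x) S"
  using Ck_on_scaleR[OF assms] by simp

lemma smooth_on_inverse: "smooth_on (- {0}) (inverse :: real \<Rightarrow> real)"
proof (rule smooth_on_deriv_chain[where G = "\<lambda>y. (- 1) * (y * y)"])
  fix x :: real assume "x \<in> - {0}"
  then show "(inverse has_real_derivative (- 1) * (inverse x * inverse x)) (at x)"
    by (auto intro!: derivative_eq_intros simp: power2_eq_square)
qed (rule Ck_on_mult Ck_on_const | assumption | force)+

lemma Ck_on_inverse: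
  fixes f :: "'a::euclidean_space \<Rightarrow> real"
  assumes "open S" "Ck_on k f S" "\<And>x. x \<in> S \<Longrightarrow> f x \<noteq> 0" shows "Ck_on k (\<lambda>x. inverse (f x)) S"
  by (rule Ck_on_compose[OF assms(1) _ assms(2) smooth_on_inverse[unfolded smooth_on_def, rule_format]])
     (use assms(3) in auto)

lemma smooth_on_sqrt: "smooth_on {0<..} sqrt"
proof (rule smooth_on_deriv_chain[where G = "\<lambda>y. inverse 2 * inverse y"])
  fix x :: real assume "x \<in> {0<..}"
  then show "(sqrt has_real_derivative inverse 2 * inverse (sqrt x)) (at x)"
    by (auto intro!: derivative_eq_intros simp: field_simps)
qed (rule Ck_on_mult Ck_on_const Ck_on_inverse | assumption | force)+

lemma Ck_on_sin_cos: "Ck_on k (sin :: real \<Rightarrow> real) UNIV \<and> Ck_on k (cos :: real \<Rightarrow> real) UNIV"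
proof (induction k)
  case 0
  show ?case by (auto intro: continuous_intros)
next
  case (Suc k)
  have "Ck_on (Suc k) (sin :: real \<Rightarrow> real) UNIV"
    by (rule Ck_on_SucI_real[of _ _ cos]) (use Suc in \<open>auto intro!: derivative_eq_intros\<close>)
  moreover have "Ck_on (Suc k) (cos :: real \<Rightarrow> real) UNIV"
    by (rule Ck_on_SucI_real[OF open_UNIV _ Ck_on_mult[OF open_UNIV Ck_on_const[of k "- 1"] conjunct1[OF Suc]]])
       (auto intro!: derivative_eq_intros)
  ultimately show ?case by simp
qed

lemma smooth_on_subset: "smooth_on S f \<Longrightarrow> T \<subseteq> S \<Longrightarrow> smooth_on T f"
  by (auto simp: smooth_on_def intro: Ck_on_subset)

lemma smooth_on_const: "smooth_on S (\<lambda>x. c)"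
  by (simp add: smooth_on_def Ck_on_const)

lemma smooth_on_bounded_linear: "bounded_linear f \<Longrightarrow> open S \<Longrightarrow> smooth_on S f"
  by (simp add: smooth_on_def Ck_on_bounded_linear)

lemma smooth_on_add: "open S \<Longrightarrow> smooth_on S f \<Longrightarrow> smooth_on S g \<Longrightarrow> smooth_on S (\<lambda>x. f x + g x)"
  by (simp add: smooth_on_def Ck_on_add)

lemma smooth_on_scaleR:
  fixes f :: "'a::euclidean_space \<Rightarrow> real"
  shows "open S \<Longrightarrow> smooth_on S f \<Longrightarrow> smooth_on S g \<Longrightarrow> smooth_on S (\<lambda>x. f x *\<^sub>R g x)"
  by (simp add: smooth_on_def Ck_on_scaleR)

lemma smooth_on_mult:
  fixes f g :: "'a::euclidean_space \<Rightarrow> real"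
  shows "open S \<Longrightarrow> smooth_on S f \<Longrightarrow> smooth_on S g \<Longrightarrow> smooth_on S (\<lambda>x. f x * g x)"
  by (simp add: smooth_on_def Ck_on_mult)

lemma smooth_on_compose:
  fixes f :: "'a::euclidean_space \<Rightarrow> real"
  shows "open S \<Longrightarrow> f ` S \<subseteq> T \<Longrightarrow> smooth_on S f \<Longrightarrow> smooth_on T g \<Longrightarrow> smooth_on S (\<lambda>x. g (f x))"
  unfolding smooth_on_def using Ck_on_compose by blast

lemma smooth_on_inverse_fun:
  fixes f :: "'a::euclidean_space \<Rightarrow> real"
  shows "open S \<Longrightarrow> smooth_on S f \<Longrightarrow> (\<And>x. x \<in> S \<Longrightarrow> f x \<noteq> 0) \<Longrightarrow> smooth_on S (\<lambda>x. inverse (f x))"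
  unfolding smooth_on_def using Ck_on_inverse by blast

lemma smooth_on_sin: "open S \<Longrightarrow> smooth_on S f \<Longrightarrow> smooth_on S (\<lambda>x. sin (f x :: real))"
  by (rule smooth_on_compose[of S f UNIV sin]) (simp_all add: smooth_on_def Ck_on_sin_cos)

lemma smooth_on_cos: "open S \<Longrightarrow> smooth_on S f \<Longrightarrow> smooth_on S (\<lambda>x. cos (f x :: real))"
  by (rule smooth_on_compose[of S f UNIV cos]) (simp_all add: smooth_on_def Ck_on_sin_cos)

lemma smooth_on_norm_vec2:
  fixes f :: "'a::euclidean_space \<Rightarrow> real ^ 2"
  assumes "open S" "bounded_linear f" "\<And>x. x \<in> S \<Longrightarrow> f x \<noteq> 0"
  shows "smooth_on S (\<lambda>x. norm (f x))"
proof -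
  have c: "smooth_on S (\<lambda>x. f x $ i)" for i
    using assms by (intro smooth_on_bounded_linear bounded_linear_compose[OF bounded_linear_vec_nth])
  have eq: "norm (f x) = sqrt (f x $ 1 * f x $ 1 + f x $ 2 * f x $ 2)" for x
    by (simp add: norm_eq_sqrt_inner inner_vec_def sum_2)
  have pos: "f x $ 1 * f x $ 1 + f x $ 2 * f x $ 2 > 0" if "x \<in> S" for x
    using assms(3)[OF that] by (auto simp: vec_eq_iff forall_2 sum_power2_gt_zero_iff power2_eq_square[symmetric])
  show ?thesis unfolding eq
    by (rule smooth_on_compose[OF assms(1) _ _ smooth_on_sqrt])
       (use pos in \<open>auto intro!: smooth_on_add smooth_on_mult c assms(1)\<close>)
qed

lemma smooth_on_differentiable: "smooth_on S f \<Longrightarrow> x \<in> S \<Longrightarrow> f differentiable (at x)"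
  unfolding smooth_on_def by (auto dest: spec[of _ "Suc 0"])

lemma smooth_on_real_deriv:
  fixes f :: "real \<Rightarrow> real"
  assumes "open S" "smooth_on S f" "\<And>x. x \<in> S \<Longrightarrow> (f has_real_derivative f' x) (at x)"
  shows "smooth_on S f'"
  unfolding smooth_on_def
proof
  fix k
  have "Ck_on k (\<lambda>x. frechet_derivative f (at x) 1) S"
    by (rule Ck_on_Suc_derivative[OF assms(2)[unfolded smooth_on_def, rule_format]])
  moreover have "frechet_derivative f (at x) 1 = f' x" if "x \<in> S" for x
    using assms(3)[OF that, unfolded has_field_derivative_def] frechet_derivative_at by (metis mult.right_neutral)
  ultimately show "Ck_on k f' S" by (rule Ck_on_cong[OF assms(1), rotated])
qed

text \<open>
  The inverse \<open>g\<close> satisfies \<open>g' = 1 / (h' \<circ> g)\<close>, so \<open>smooth_on_deriv_chain\<close> makes it smooth.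
\<close>

lemma smooth_local_inverse:
  fixes h h' :: "real \<Rightarrow> real"
  assumes h: "smooth_on UNIV h" and D: "\<And>x. (h has_real_derivative h' x) (at x)" and pos: "h' c > 0"
  obtains d g where "d > 0" "open (h ` {c - d<..<c + d})" "smooth_on (h ` {c - d<..<c + d}) g"
    "\<And>x. x \<in> {c - d<..<c + d} \<Longrightarrow> g (h x) = x"
proof -
  have h': "smooth_on UNIV h'" using smooth_on_real_deriv[OF open_UNIV h] D by blast
  then have "continuous_on UNIV h'" unfolding smooth_on_def by (auto dest: spec[of _ 0])
  then have "isCont h' c" by (simp add: continuous_on_eq_continuous_at)
  then have "\<forall>\<^sub>F x in nhds c. h' x > 0"
    using pos order_tendstoD(1)[of h' "h' c" "nhds c" 0] by (simp add: continuous_within tendsto_at_iff_tendsto_nhds)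
  then obtain d where d: "d > 0" "\<And>x. dist x c < d \<Longrightarrow> h' x > 0"
    by (auto simp: eventually_nhds_metric)
  define I where "I = {c - d<..<c + d}"
  have pI: "h' x > 0" if "x \<in> I" for x using that d(2) by (auto simp: I_def dist_real_def abs_less_iff)
  have neI: "h' x \<noteq> 0" if "x \<in> I" for x using pI[OF that] by simp
  have mono: "h x < h y" if "x \<in> I" "y \<in> I" "x < y" for x y
  proof (rule DERIV_pos_imp_increasing[OF that(3)])
    fix z assume "x \<le> z" "z \<le> y"
    then have "z \<in> I" using that by (auto simp: I_def)
    then show "\<exists>d. (h has_real_derivative d) (at z) \<and> 0 < d" using pI D by blast
  qed
  have inj: "inj_on h I" using mono by (metis inj_onI linorder_neqE less_irrefl)
  have ch: "continuous_on T h" for T using D by (auto intro!: continuous_at_imp_continuous_on DERIV_isCont)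
  have op: "open (h ` I)"
    using inj ch by (intro invariance_of_domain) (auto simp: I_def)
  define g where "g = inv_into I h"
  have gh: "g (h x) = x" if "x \<in> I" for x using inj that by (simp add: g_def)
  have Dg: "(g has_real_derivative inverse (h' (g y))) (at y)" if y: "y \<in> h ` I" for y
  proof -
    obtain x where x: "x \<in> I" "y = h x" using y by blast
    have "(g has_derivative (*) (inverse (h' x))) (at (h x))"
      by (rule has_derivative_inverse_strong[OF _ x(1) ch gh D[unfolded has_field_derivative_def]])
         (use x pI[OF x(1)] in \<open>auto simp: I_def fun_eq_iff\<close>)
    then have "(g has_real_derivative inverse (h' x)) (at (h x))"
      by (simp add: has_field_derivative_def)
    then show ?thesis using x gh by simp
  qed
  have g1: "g ` h ` I \<subseteq> I" using gh by auto
  have "smooth_on (h ` I) g"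
  proof (rule smooth_on_deriv_chain[OF op Dg])
    fix k assume "Ck_on k g (h ` I)"
    then show "Ck_on k (\<lambda>x. inverse (h' (g x))) (h ` I)"
      using h' g1 by (intro Ck_on_inverse Ck_on_compose[where g = h' and f = g and T = UNIV] op neI)
        (auto simp: smooth_on_def)
  qed
  then show thesis using that[of d g] d(1) op gh unfolding I_def by blast
qed

section \<open>Rotating a curve about two planes\<close>

text \<open>
  Every residue class modulo \<open>P\<close> meets the closed interval of length \<open>P\<close> around \<open>c\<close>.
\<close>

lemma translate_into_period:
  fixes x c P :: real
  assumes "P > 0"
  obtains k :: int where "\<bar>x + of_int k * P - c\<bar> \<le> P / 2"
proof
  let ?r = "round ((x - c) / P)"
  have "x + of_int (- ?r) * P - c = ((x - c) / P - of_int ?r) * P" using assms by (simp add: field_simps)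
  moreover have "\<bar>(x - c) / P - of_int ?r\<bar> \<le> 1 / 2" using of_int_round_abs_le[of "(x - c) / P"] by linarith
  ultimately show "\<bar>x + of_int (- ?r) * P - c\<bar> \<le> P / 2"
    using assms mult_right_mono[of _ "1/2" P] by (simp add: abs_mult)
qed

lemma periodic_of_int:
  fixes f :: "real \<Rightarrow> 'b"
  assumes "\<And>x. f (x + L) = f x" shows "f (x + of_int k * L) = f x"
proof -
  interpret periodic_fun_simple f L by standard (rule assms)
  show ?thesis by (rule plus_of_int)
qed

definition circle_pt :: "real \<Rightarrow> real ^ 2" where
  "circle_pt u = cos u *\<^sub>R axis 1 1 + sin u *\<^sub>R axis 2 1"

definition circle_tangent :: "real \<Rightarrow> real ^ 2" where
  "circle_tangent u = - sin u *\<^sub>R axis 1 1 + cos u *\<^sub>R axis 2 1"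

lemma circle_inner [simp]:
  "circle_pt u \<bullet> circle_pt u = 1" "circle_tangent u \<bullet> circle_tangent u = 1" "circle_pt u \<bullet> circle_tangent u = 0" "circle_tangent u \<bullet> circle_pt u = 0"
  by (simp_all add: circle_pt_def circle_tangent_def inner_add_left inner_add_right inner_diff_left
      inner_diff_right inner_axis_axis power2_eq_square[symmetric])

lemma norm_circle [simp]: "norm (circle_pt u) = 1" "norm (circle_tangent u) = 1"
  by (simp_all add: norm_eq_sqrt_inner)

lemma circle_pt_has_derivative: "(circle_pt has_derivative (\<lambda>h. h *\<^sub>R circle_tangent u)) (at u)"
  unfolding circle_pt_def circle_tangent_def by (auto intro!: derivative_eq_intros simp: algebra_simps)

lemma circle_frame_expansion: "w = (w \<bullet> circle_pt u) *\<^sub>R circle_pt u + (w \<bullet> circle_tangent u) *\<^sub>R circle_tangent u"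
proof -
  have eq: "cos u * (cos u * x) + sin u * (sin u * x) = x" for x
  proof -
    have eq: "cos u * (cos u * x) + sin u * (sin u * x) = ((cos u)\<^sup>2 + (sin u)\<^sup>2) * x"
      by (simp only: power2_eq_square algebra_simps)
    then show ?thesis by simp
  qed
  show ?thesis
    unfolding vec_eq_iff forall_2
    by (simp add: circle_pt_def circle_tangent_def inner_vec_def sum_2 axis_def algebra_simps) (simp add: eq)
qed

lemma circle_pt_eq_iff: "circle_pt u = circle_pt u' \<longleftrightarrow> (\<exists>k::int. u' = u + of_int k * (2 * pi))"
proof -
  have "circle_pt u = circle_pt u' \<longleftrightarrow> sin u' = sin u \<and> cos u' = cos u"
    by (auto simp: circle_pt_def vec_eq_iff forall_2 axis_def)
  then show ?thesis by (simp add: sin_cos_eq_iff algebra_simps)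
qed

lemma sphere_eq_range_circle_pt: "sphere 0 1 = range circle_pt"
proof (intro equalityI subsetI)
  fix y :: "real ^ 2" assume "y \<in> sphere 0 1"
  then have "(y $ 1)\<^sup>2 + (y $ 2)\<^sup>2 = 1"
    by (simp add: norm_eq_sqrt_inner inner_vec_def sum_2 power2_eq_square)
  then obtain u where "y $ 1 = cos u" "y $ 2 = sin u" using sincos_total_2pi by metis
  then show "y \<in> range circle_pt"
    by (intro image_eqI[of _ _ u]) (auto simp: circle_pt_def vec_eq_iff forall_2 axis_def)
qed auto

text \<open>
  The vector of the ambient space with components \<open>a\<close>, \<open>b\<close> in the radial directions of the
  two planes at angles \<open>u\<close>, \<open>v\<close>; points, velocities and normals of the hypersurface have this form.
\<close>

definition torus_vec :: "real \<Rightarrow> real \<Rightarrow> real \<Rightarrow> real \<Rightarrow> real \<Rightarrow> R5" where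
  "torus_vec a b c u v = (a *\<^sub>R circle_pt u, b *\<^sub>R circle_pt v, c)"

lemma torus_vec_inner:
  "torus_vec a b c u v \<bullet> torus_vec a' b' c' u v = a * a' + b * b' + c * c'"
  by (simp add: torus_vec_def inner_prod_def)

lemma torus_vec_perp_inner [simp]:
  "torus_vec a b c u v \<bullet> (circle_tangent u, 0, 0) = 0" "torus_vec a b c u v \<bullet> (0, circle_tangent v, 0) = 0"
  by (simp_all add: torus_vec_def inner_prod_def)

lemma torus_vec_scaleR: "k *\<^sub>R torus_vec a b c u v = torus_vec (k * a) (k * b) (k * c) u v"
  by (simp add: torus_vec_def)

lemma smooth_on_torus_vec:
  assumes S: "open S" and sm: "smooth_on S a" "smooth_on S b" "smooth_on S c" "smooth_on S u" "smooth_on S v"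
  shows "smooth_on S (\<lambda>x. torus_vec (a x) (b x) (c x) (u x) (v x))"
proof -
  have eq: "torus_vec (a x) (b x) (c x) (u x) (v x) =
      (a x * cos (u x)) *\<^sub>R (axis 1 1, 0, 0) + (a x * sin (u x)) *\<^sub>R (axis 2 1, 0, 0) +
      ((b x * cos (v x)) *\<^sub>R (0, axis 1 1, 0) + (b x * sin (v x)) *\<^sub>R (0, axis 2 1, 0) + c x *\<^sub>R (0, 0, 1))" for x
    by (simp add: torus_vec_def circle_pt_def scaleR_add_right)
  show ?thesis unfolding eq
    by (intro smooth_on_add smooth_on_scaleR smooth_on_mult smooth_on_const smooth_on_sin smooth_on_cos S sm)
qed

text \<open>
  The points and the normal vectors of the hypersurface are of this form, with \<open>a\<close>, \<open>b\<close> and \<open>c\<close>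
  functions of the parameter of the profile curve, so one computation serves both.
\<close>

lemma torus_vec_has_derivative:
  assumes "(a has_real_derivative a') (at s)" "(b has_real_derivative b') (at s)" "(c has_real_derivative c') (at s)"
    and "(f has_derivative f') (at x)" "(u has_derivative u') (at x)" "(v has_derivative v') (at x)" and s: "f x = s"
  shows "((\<lambda>x. torus_vec (a (f x)) (b (f x)) (c (f x)) (u x) (v x)) has_derivative
    (\<lambda>h. f' h *\<^sub>R torus_vec a' b' c' (u x) (v x) + (a s * u' h) *\<^sub>R (circle_tangent (u x), 0, 0)
         + (b s * v' h) *\<^sub>R (0, circle_tangent (v x), 0))) (at x)"
proof -
  have D: "((\<lambda>x. g (f x)) has_derivative (\<lambda>h. f' h * g')) (at x)" if "(g has_real_derivative g') (at s)" for g g'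
    using has_derivative_compose[OF assms(4), of g "(*) g'"] that s
    by (simp add: has_field_derivative_def mult.commute)
  have C: "((\<lambda>x. circle_pt (w x)) has_derivative (\<lambda>h. w' h *\<^sub>R circle_tangent (w x))) (at x)"
    if "(w has_derivative w') (at x)" for w w'
    by (rule has_derivative_compose[OF that circle_pt_has_derivative])
  show ?thesis
    unfolding torus_vec_def
    by (rule has_derivative_eq_rhs[OF has_derivative_Pair[OF has_derivative_scaleR[OF D[OF assms(1)] C[OF assms(5)]]
          has_derivative_Pair[OF has_derivative_scaleR[OF D[OF assms(2)] C[OF assms(6)]] D[OF assms(3)]]]])
       (auto simp: s fun_eq_iff algebra_simps)
qed



lemma mem_cbox_centered:
  fixes c h :: "real ^ 'n"
  shows "x \<in> cbox (c - h) (c + h) \<longleftrightarrow> (\<forall>i. \<bar>x $ i - c $ i\<bar> \<le> h $ i)"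
  by (auto simp: mem_box_cart abs_le_iff algebra_simps)

lemma mem_box_centered:
  fixes c h :: "real ^ 'n"
  shows "x \<in> box (c - h) (c + h) \<longleftrightarrow> (\<forall>i. \<bar>x $ i - c $ i\<bar> < h $ i)"
  by (auto simp: mem_box_cart abs_less_iff algebra_simps)

lemma coordinate_curve_has_vector_derivative:
  "((\<lambda>\<tau>. torus_vec (A (s + \<tau> * a)) (B (s + \<tau> * a)) (C (s + \<tau> * a)) (u + \<tau> * b) (v + \<tau> * c))
     has_vector_derivative (a *\<^sub>R torus_vec A' B' C' u v + (A s * b) *\<^sub>R (circle_tangent u, 0, 0) + (B s * c) *\<^sub>R (0, circle_tangent v, 0))) (at 0)"
  if "(A has_real_derivative A') (at s)" "(B has_real_derivative B') (at s)" "(C has_real_derivative C') (at s)"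
proof -
  have lin: "((\<lambda>\<tau>. x + \<tau> * y) has_derivative (\<lambda>h. h * y)) (at 0)" for x y :: real
    by (auto intro!: derivative_eq_intros)
  show ?thesis
    unfolding has_vector_derivative_def
    by (rule has_derivative_eq_rhs[OF torus_vec_has_derivative[OF that lin lin lin]])
       (simp_all add: fun_eq_iff scaleR_add_right mult_ac)
qed

text \<open>
  The great circle through \<open>p\<close> in direction \<open>v\<close> is the required curve.
\<close>

lemma tangent_space_sphere:
  fixes p v :: "'a::euclidean_space"
  assumes "norm p = 1" "norm v = 1" "p \<bullet> v = 0"
  shows "v \<in> tangent_space (sphere 0 1) p"
proof -
  define c where "c \<tau> = cos \<tau> *\<^sub>R p + sin \<tau> *\<^sub>R v" for \<tau> :: real
  have "smooth_on {-1<..<1} c" unfolding c_def[abs_def]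
    by (intro smooth_on_add smooth_on_scaleR smooth_on_cos smooth_on_sin smooth_on_const
        smooth_on_bounded_linear bounded_linear_ident open_greaterThanLessThan)
  moreover have "norm (c \<tau>) = 1" for \<tau>
  proof -
    have "p \<bullet> p = 1" "v \<bullet> v = 1" "v \<bullet> p = 0" using assms by (simp_all add: dot_square_norm inner_commute)
    then have "(norm (c \<tau>))\<^sup>2 = 1" using assms(3)
      by (simp add: power2_norm_eq_inner c_def inner_add_left inner_add_right power2_eq_square[symmetric])
    then show ?thesis using norm_ge_zero[of "c \<tau>"] by (auto simp: power2_eq_1_iff)
  qed
  then have "c ` {-1<..<1} \<subseteq> sphere 0 1" by auto
  moreover have "(c has_vector_derivative v) (at 0)"
    unfolding c_def[abs_def] has_vector_derivative_def by (auto intro!: derivative_eq_intros)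
  ultimately show ?thesis
    unfolding tangent_space_def by (intro CollectI exI[of _ 1] conjI exI[of _ c]) (auto simp: c_def)
qed

text \<open>
  A simple closed unit-speed curve \<open>(X, Y, Z)\<close> of period \<open>L\<close> in the part \<open>X > 0\<close>, \<open>Y > 0\<close> of the unit
  sphere, together with its unit normal \<open>(n1, n2, n3)\<close> in the sphere and the geodesic curvature \<open>\<kappa>\<close>,
  which enters through the derivative of the normal, \<open>- \<kappa>\<close> times the velocity.
\<close>

locale profile_curve =
  fixes X Y Z X' Y' Z' n1 n2 n3 \<kappa> :: "real \<Rightarrow> real" and L :: real
  assumes smooth: "smooth_on UNIV X" "smooth_on UNIV Y" "smooth_on UNIV Z"
      "smooth_on UNIV n1" "smooth_on UNIV n2" "smooth_on UNIV n3"
    and D: "(X has_real_derivative X' s) (at s)" "(Y has_real_derivative Y' s) (at s)"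
      "(Z has_real_derivative Z' s) (at s)"
    and Dn: "(n1 has_real_derivative - \<kappa> s * X' s) (at s)" "(n2 has_real_derivative - \<kappa> s * Y' s) (at s)"
      "(n3 has_real_derivative - \<kappa> s * Z' s) (at s)"
    and pos: "X s > 0" "Y s > 0"
    and unit: "X s * X s + Y s * Y s + Z s * Z s = 1" "X' s * X' s + Y' s * Y' s + Z' s * Z' s = 1"
      "n1 s * n1 s + n2 s * n2 s + n3 s * n3 s = 1"
    and orth: "X s * X' s + Y s * Y' s + Z s * Z' s = 0" "X s * n1 s + Y s * n2 s + Z s * n3 s = 0"
      "n1 s * X' s + n2 s * Y' s + n3 s * Z' s = 0"
    and L: "L > 0"
    and periodic: "X (s + L) = X s" "Y (s + L) = Y s" "Z (s + L) = Z s"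
      "n1 (s + L) = n1 s" "n2 (s + L) = n2 s" "n3 (s + L) = n3 s"
    and simple: "X s = X s' \<Longrightarrow> Y s = Y s' \<Longrightarrow> Z s = Z s' \<Longrightarrow> \<exists>k::int. s' = s + of_int k * L"
begin

definition orbit_pt :: "real \<Rightarrow> real \<Rightarrow> real \<Rightarrow> R5" where
  "orbit_pt s u v = torus_vec (X s) (Y s) (Z s) u v"

definition orbit_normal :: "real \<Rightarrow> real \<Rightarrow> real \<Rightarrow> R5" where
  "orbit_normal s u v = torus_vec (n1 s) (n2 s) (n3 s) u v"

definition orbit_tangent :: "real \<Rightarrow> real \<Rightarrow> real \<Rightarrow> R5" where
  "orbit_tangent s u v = torus_vec (X' s) (Y' s) (Z' s) u v"

definition \<Phi> :: "real ^ 3 \<Rightarrow> R5" where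
  "\<Phi> w = orbit_pt (w $ 1) (w $ 2) (w $ 3)"

definition hypersurface :: "R5 set" where
  "hypersurface = range \<Phi>"

lemma orbit_pt_in_hypersurface: "orbit_pt s u v \<in> hypersurface"
proof -
  have "orbit_pt s u v = \<Phi> (vector [s, u, v])" by (simp add: \<Phi>_def)
  then show ?thesis by (auto simp: hypersurface_def)
qed

lemma hypersurfaceE:
  assumes "p \<in> hypersurface" obtains s u v where "p = orbit_pt s u v"
  using assms by (auto simp: hypersurface_def \<Phi>_def)

lemma orbit_pt_components:
  "norm (fst (orbit_pt s u v)) = X s" "norm (fst (snd (orbit_pt s u v))) = Y s" "snd (snd (orbit_pt s u v)) = Z s"
  using pos[of s] by (auto simp: orbit_pt_def torus_vec_def)

lemma orbit_pt_eq_iff: "orbit_pt s u v = orbit_pt s' u' v' \<longleftrightarrow>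
    (\<exists>k::int. s' = s + of_int k * L) \<and> (\<exists>k::int. u' = u + of_int k * (2 * pi)) \<and> (\<exists>k::int. v' = v + of_int k * (2 * pi))"
proof
  assume eq: "orbit_pt s u v = orbit_pt s' u' v'"
  then have c: "X s = X s'" "Y s = Y s'" "Z s = Z s'" using orbit_pt_components by metis+
  moreover have "circle_pt u = circle_pt u'" "circle_pt v = circle_pt v'"
    using eq c pos[of s'] by (auto simp: orbit_pt_def torus_vec_def)
  ultimately show "(\<exists>k::int. s' = s + of_int k * L) \<and> (\<exists>k::int. u' = u + of_int k * (2 * pi)) \<and> (\<exists>k::int. v' = v + of_int k * (2 * pi))"
    using simple circle_pt_eq_iff by blast
next
  assume "(\<exists>k::int. s' = s + of_int k * L) \<and> (\<exists>k::int. u' = u + of_int k * (2 * pi)) \<and> (\<exists>k::int. v' = v + of_int k * (2 * pi))"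
  then have "circle_pt u = circle_pt u'" "circle_pt v = circle_pt v'" "X s' = X s" "Y s' = Y s" "Z s' = Z s"
    using circle_pt_eq_iff periodic_of_int[of X, OF periodic(1)] periodic_of_int[of Y, OF periodic(2)]
      periodic_of_int[of Z, OF periodic(3)] by auto
  then show "orbit_pt s u v = orbit_pt s' u' v'" by (simp add: orbit_pt_def torus_vec_def)
qed

definition periods :: "real ^ 3" where "periods = vector [L, 2 * pi, 2 * pi]"

lemma periods_pos: "periods $ i > 0"
  using L exhaust_3[of i] by (auto simp: periods_def)

lemma \<Phi>_eq_iff: "\<Phi> w = \<Phi> w' \<longleftrightarrow> (\<forall>i. \<exists>k::int. w' $ i = w $ i + of_int k * periods $ i)"
  by (simp add: \<Phi>_def orbit_pt_eq_iff forall_3 periods_def)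

text \<open>
  Two parameters of one point differ by multiples of the periods, so they coincide if they differ by
  less than one period.
\<close>

lemma \<Phi>_injective:
  assumes "\<Phi> w = \<Phi> w'" "\<And>i. \<bar>w' $ i - w $ i\<bar> < periods $ i" shows "w = w'"
proof -
  have "w' $ i = w $ i" for i
  proof -
    obtain k :: int where k: "w' $ i = w $ i + of_int k * periods $ i" using assms(1) \<Phi>_eq_iff by blast
    then have "\<bar>of_int k\<bar> * periods $ i < 1 * periods $ i"
      using assms(2)[of i] periods_pos[of i] by (simp add: abs_mult)
    then have "\<bar>real_of_int k\<bar> < 1" using periods_pos[of i] by (simp only: mult_less_cancel_right_pos)
    then have "k = 0" by linarith
    then show ?thesis using k by simp
  qed
  then show ?thesis by (simp add: vec_eq_iff)
qed

lemma \<Phi>_smooth: "smooth_on UNIV \<Phi>"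
proof -
  have c: "smooth_on UNIV (\<lambda>w::real ^ 3. w $ i)" for i
    by (rule smooth_on_bounded_linear[OF bounded_linear_vec_nth open_UNIV])
  have cf: "smooth_on UNIV (\<lambda>w::real ^ 3. f (w $ 1))" if "smooth_on UNIV f" for f :: "real \<Rightarrow> real"
    by (rule smooth_on_compose[OF open_UNIV subset_UNIV c that])
  show ?thesis
    unfolding \<Phi>_def[abs_def] orbit_pt_def by (intro smooth_on_torus_vec c cf smooth open_UNIV)
qed

lemma \<Phi>_has_derivative:
  "(\<Phi> has_derivative (\<lambda>h. h $ 1 *\<^sub>R orbit_tangent (w $ 1) (w $ 2) (w $ 3)
      + (X (w $ 1) * h $ 2) *\<^sub>R (circle_tangent (w $ 2), 0, 0) + (Y (w $ 1) * h $ 3) *\<^sub>R (0, circle_tangent (w $ 3), 0))) (at w)"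
  unfolding \<Phi>_def[abs_def] orbit_pt_def orbit_tangent_def
  by (intro torus_vec_has_derivative D bounded_linear_imp_has_derivative bounded_linear_vec_nth refl)

lemma \<Phi>_continuous: "continuous_on S \<Phi>"
  using \<Phi>_has_derivative has_derivative_continuous continuous_at_imp_continuous_on by blast

lemma frame_inner [simp]:
  "orbit_tangent s u v \<bullet> orbit_tangent s u v = 1" "orbit_pt s u v \<bullet> orbit_pt s u v = 1" "orbit_normal s u v \<bullet> orbit_normal s u v = 1"
  "orbit_tangent s u v \<bullet> orbit_pt s u v = 0" "orbit_pt s u v \<bullet> orbit_tangent s u v = 0" "orbit_pt s u v \<bullet> orbit_normal s u v = 0"
  "orbit_normal s u v \<bullet> orbit_pt s u v = 0" "orbit_normal s u v \<bullet> orbit_tangent s u v = 0"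
  "orbit_tangent s u v \<bullet> (circle_tangent u, 0, 0) = 0" "orbit_tangent s u v \<bullet> (0, circle_tangent v, 0) = 0"
  "orbit_pt s u v \<bullet> (circle_tangent u, 0, 0) = 0" "orbit_pt s u v \<bullet> (0, circle_tangent v, 0) = 0"
  "orbit_normal s u v \<bullet> (circle_tangent u, 0, 0) = 0" "orbit_normal s u v \<bullet> (0, circle_tangent v, 0) = 0"
  using unit[of s] orth[of s]
  by (simp_all add: orbit_tangent_def orbit_pt_def orbit_normal_def torus_vec_inner mult.commute)

lemma perp_inner [simp]:
  "(circle_tangent u, 0, 0) \<bullet> ((circle_tangent u, 0, 0) :: R5) = 1" "(0, circle_tangent v, 0) \<bullet> ((0, circle_tangent v, 0) :: R5) = 1"
  "(circle_tangent u, 0, 0) \<bullet> ((0, circle_tangent v, 0) :: R5) = 0" "(0, circle_tangent v, 0) \<bullet> ((circle_tangent u, 0, 0) :: R5) = 0"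
  by (simp_all add: inner_prod_def)

lemma frame_inner_commuted [simp]:
  "(circle_tangent u, 0, 0) \<bullet> orbit_tangent s u v = 0" "(0, circle_tangent v, 0) \<bullet> orbit_tangent s u v = 0"
  "(circle_tangent u, 0, 0) \<bullet> orbit_pt s u v = 0" "(0, circle_tangent v, 0) \<bullet> orbit_pt s u v = 0"
  using frame_inner by (metis inner_commute)+

text \<open>
  The three partial derivatives are multiples of orthonormal vectors, with factors \<open>1\<close>, \<open>X\<close> and \<open>Y\<close>.
\<close>

lemma \<Phi>_immersion: "inj (frechet_derivative \<Phi> (at w))"
proof -
  define f' where "f' = (\<lambda>h::real ^ 3. h $ 1 *\<^sub>R orbit_tangent (w $ 1) (w $ 2) (w $ 3)
      + (X (w $ 1) * h $ 2) *\<^sub>R (circle_tangent (w $ 2), 0, 0) + (Y (w $ 1) * h $ 3) *\<^sub>R (0, circle_tangent (w $ 3), 0::real))"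
  have D: "(\<Phi> has_derivative f') (at w)" unfolding f'_def by (rule \<Phi>_has_derivative)
  have "h = 0" if "f' h = 0" for h
  proof -
    have "f' h \<bullet> orbit_tangent (w $ 1) (w $ 2) (w $ 3) = h $ 1" "f' h \<bullet> (circle_tangent (w $ 2), 0, 0) = X (w $ 1) * h $ 2"
      "f' h \<bullet> (0, circle_tangent (w $ 3), 0) = Y (w $ 1) * h $ 3"
      unfolding f'_def by (simp_all only: inner_add_left inner_scaleR_left frame_inner perp_inner frame_inner_commuted mult_1_right mult_zero_right add_0_left add_0_right)
    then show "h = 0" using that pos[of "w $ 1"] by (simp add: vec_eq_iff forall_3)
  qed
  then have "inj f'" using has_derivative_linear[OF D] linear_injective_0 by blast
  then show ?thesis using frechet_derivative_at[OF D] by simp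
qed

text \<open>
  Let \<open>C\<close> be the closed box of one full period around \<open>w0\<close>. It covers the hypersurface, and the part of \<open>C\<close>
  outside \<open>U\<close> is compact; the complement of its image is the required ambient open set. It does not
  lose points of the image of \<open>U\<close>, since points of \<open>U\<close> and of \<open>C\<close> are less than one period apart. The inverse is
  continuous because \<open>\<Phi>\<close> is injective on the compact closure of \<open>U\<close>.
\<close>

lemma \<Phi>_open_embedding:
  fixes w0 :: "real ^ 3"
  assumes e: "0 < e" "e \<le> 1 / 4"
  defines "U \<equiv> box (w0 - e *\<^sub>R periods) (w0 + e *\<^sub>R periods)"
  obtains W \<psi> where "open W" "hypersurface \<inter> W = \<Phi> ` U" "homeomorphism U (hypersurface \<inter> W) \<Phi> \<psi>"
proof -
  have memU: "w \<in> U \<longleftrightarrow> (\<forall>i. \<bar>w $ i - w0 $ i\<bar> < e * periods $ i)" for w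
    unfolding U_def mem_box_centered by simp
  define C where "C = cbox (w0 - (1 / 2) *\<^sub>R periods) (w0 + (1 / 2) *\<^sub>R periods)"
  have memC: "w \<in> C \<longleftrightarrow> (\<forall>i. \<bar>w $ i - w0 $ i\<bar> \<le> periods $ i / 2)" for w
    unfolding C_def mem_cbox_centered by simp
  define U' where "U' = cbox (w0 - e *\<^sub>R periods) (w0 + e *\<^sub>R periods)"
  have memU': "w \<in> U' \<longleftrightarrow> (\<forall>i. \<bar>w $ i - w0 $ i\<bar> \<le> e * periods $ i)" for w
    unfolding U'_def mem_cbox_centered by simp
  have e': "e * periods $ i \<le> periods $ i / 4" for i
    using mult_right_mono[OF e(2), of "periods $ i"] periods_pos[of i] by simp
  define W where "W = - \<Phi> ` (C - U)"
  have "compact (C - U)" unfolding C_def U_def by (intro compact_diff compact_cbox open_box)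
  then have oW: "open W"
    unfolding W_def using \<Phi>_continuous compact_continuous_image compact_imp_closed open_Compl by blast
  have MW: "hypersurface \<inter> W = \<Phi> ` U"
  proof (intro equalityI subsetI)
    fix q assume q: "q \<in> hypersurface \<inter> W"
    then obtain w where w: "q = \<Phi> w" by (auto simp: hypersurface_def)
    have "\<exists>k::int. \<bar>w $ i + of_int k * periods $ i - w0 $ i\<bar> \<le> periods $ i / 2" for i
      using translate_into_period[OF periods_pos] by metis
    then obtain k :: "3 \<Rightarrow> int" where k: "\<And>i. \<bar>w $ i + of_int (k i) * periods $ i - w0 $ i\<bar> \<le> periods $ i / 2"
      by metis
    define w' where "w' = (\<chi> i. w $ i + of_int (k i) * periods $ i)"
    have "\<Phi> w = \<Phi> w'" unfolding \<Phi>_eq_iff by (auto simp: w'_def)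
    moreover have "w' \<in> C" unfolding memC using k by (simp add: w'_def)
    ultimately show "q \<in> \<Phi> ` U" using q w unfolding W_def by auto
  next
    fix q assume "q \<in> \<Phi> ` U"
    then obtain w where w: "w \<in> U" "q = \<Phi> w" by blast
    have "q \<notin> \<Phi> ` (C - U)"
    proof
      assume "q \<in> \<Phi> ` (C - U)"
      then obtain w' where w': "w' \<in> C" "w' \<notin> U" "q = \<Phi> w'" by blast
      have "\<bar>w' $ i - w $ i\<bar> < periods $ i" for i
      proof -
        have "\<bar>w $ i - w0 $ i\<bar> < e * periods $ i" "\<bar>w' $ i - w0 $ i\<bar> \<le> periods $ i / 2"
          using w(1) w'(1) memU memC by blast+
        then show ?thesis using e'[of i] periods_pos[of i] by linarith
      qed
      then show False using \<Phi>_injective[of w w'] w w' by simp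
    qed
    then show "q \<in> hypersurface \<inter> W" using w by (auto simp: W_def hypersurface_def)
  qed
  have "inj_on \<Phi> U'"
  proof
    fix w w' assume w: "w \<in> U'" "w' \<in> U'" "\<Phi> w = \<Phi> w'"
    have "\<bar>w' $ i - w $ i\<bar> < periods $ i" for i
    proof -
      have "\<bar>w $ i - w0 $ i\<bar> \<le> e * periods $ i" "\<bar>w' $ i - w0 $ i\<bar> \<le> e * periods $ i"
        using w memU' by blast+
      then show ?thesis using e'[of i] periods_pos[of i] by linarith
    qed
    then show "w = w'" using \<Phi>_injective w by blast
  qed
  moreover have "compact U'" by (simp add: U'_def)
  ultimately obtain \<psi> where "homeomorphism U' (\<Phi> ` U') \<Phi> \<psi>"
    using homeomorphism_compact[of U' \<Phi> "\<Phi> ` U'"] \<Phi>_continuous by blast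
  moreover have "U \<subseteq> U'" by (simp add: U_def U'_def box_subset_cbox)
  ultimately have "homeomorphism U (\<Phi> ` U) \<Phi> \<psi>"
    by (rule homeomorphism_of_subsets) (use \<open>U \<subseteq> U'\<close> in auto)
  then show thesis using that oW MW by metis
qed

lemma embedded: "embedded_hypersurface hypersurface"
  unfolding embedded_hypersurface_def
proof (intro conjI ballI subsetI)
  fix p assume "p \<in> hypersurface"
  then show "p \<in> sphere 0 1" by (auto elim!: hypersurfaceE simp: norm_eq_sqrt_inner)
next
  fix p assume "p \<in> hypersurface"
  then obtain w0 where w0: "p = \<Phi> w0" by (auto simp: hypersurface_def)
  define U where "U = box (w0 - (1/4) *\<^sub>R periods) (w0 + (1/4) *\<^sub>R periods)"
  obtain W \<psi> where W: "open W" "hypersurface \<inter> W = \<Phi> ` U" "homeomorphism U (hypersurface \<inter> W) \<Phi> \<psi>"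
    using \<Phi>_open_embedding[of "1/4" w0] unfolding U_def by auto
  have "w0 \<in> U" using periods_pos by (auto simp: U_def mem_box_cart)
  then have "p \<in> W" using W w0 by blast
  moreover have "open U" by (simp add: U_def open_box)
  ultimately have "local_parametrization hypersurface p U \<Phi>"
    unfolding local_parametrization_def using W smooth_on_subset[OF \<Phi>_smooth] \<Phi>_immersion by blast
  then show "\<exists>(U :: (real ^ 3) set) \<phi>. local_parametrization hypersurface p U \<phi>" by blast
qed

text \<open>
  The function \<open>h\<close> that projects the profile curve to its tangent line at \<open>s0\<close> has derivative \<open>1\<close> at \<open>s0\<close>,
  so it can be inverted near \<open>s0\<close>. Its value is recovered from an ambient point \<open>(P, Q, c)\<close>
  through \<open>X = |P|\<close>, \<open>Y = |Q|\<close>, \<open>Z = c\<close>.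
\<close>

lemma parameter_extends_smoothly:
  obtains W \<sigma> where "open W" "orbit_pt s0 u0 v0 \<in> W" "smooth_on W \<sigma>" "\<sigma> (orbit_pt s0 u0 v0) = s0"
    "\<And>q. q \<in> hypersurface \<inter> W \<Longrightarrow> \<exists>u v. q = orbit_pt (\<sigma> q) u v"
proof -
  define h where "h s = X' s0 * X s + (Y' s0 * Y s + Z' s0 * Z s)" for s
  define h' where "h' s = X' s0 * X' s + (Y' s0 * Y' s + Z' s0 * Z' s)" for s
  have h: "smooth_on UNIV h" unfolding h_def[abs_def]
    by (intro smooth_on_add smooth_on_mult smooth_on_const smooth open_UNIV)
  have Dh: "(h has_real_derivative h' s) (at s)" for s
    unfolding h_def[abs_def] h'_def by (auto intro!: derivative_eq_intros D)
  have "h' s0 > 0" using unit(2)[of s0] by (simp add: h'_def)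
  then obtain d g where d: "d > 0" "open (h ` {s0 - d<..<s0 + d})" "smooth_on (h ` {s0 - d<..<s0 + d}) g"
    "\<And>x. x \<in> {s0 - d<..<s0 + d} \<Longrightarrow> g (h x) = x"
    using smooth_local_inverse[OF h Dh] by metis
  define w0 :: "real ^ 3" where "w0 = vector [s0, u0, v0]"
  define e where "e = min (1/4) (d / L)"
  have e: "0 < e" "e \<le> 1/4" "e * L \<le> d" using d(1) L by (auto simp: e_def min_def field_simps)
  define U where "U = box (w0 - e *\<^sub>R periods) (w0 + e *\<^sub>R periods)"
  obtain W1 \<psi> where W1: "open W1" "hypersurface \<inter> W1 = \<Phi> ` U"
    using \<Phi>_open_embedding[OF e(1,2), of w0] unfolding U_def by metis
  have U: "w $ 1 \<in> {s0 - d<..<s0 + d}" if "w \<in> U" for w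
  proof -
    have "w0 $ 1 - e * periods $ 1 < w $ 1" "w $ 1 < w0 $ 1 + e * periods $ 1"
      using that by (auto simp: U_def mem_box_cart)
    then show ?thesis using e(3) by (simp add: w0_def periods_def)
  qed
  have p: "orbit_pt s0 u0 v0 = \<Phi> w0" by (simp add: \<Phi>_def w0_def)
  have "w0 \<in> U" using periods_pos e by (auto simp: U_def mem_box_cart)
  define \<eta> where "\<eta> q = X' s0 * norm (fst q) + (Y' s0 * norm (fst (snd q)) + Z' s0 * snd (snd q))" for q :: R5
  have \<eta>: "\<eta> (orbit_pt s u v) = h s" for s u v by (simp add: \<eta>_def h_def orbit_pt_components)
  define W where "W = W1 \<inter> ({q. fst q \<noteq> 0} \<inter> {q. fst (snd q) \<noteq> 0} \<inter> \<eta> -` (h ` {s0 - d<..<s0 + d}))"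
  have "open (\<eta> -` (h ` {s0 - d<..<s0 + d}))"
    unfolding \<eta>_def[abs_def] by (intro open_vimage d(2) continuous_intros)
  moreover have "open {q :: R5. fst q \<noteq> 0}" "open {q :: R5. fst (snd q) \<noteq> 0}"
    by (intro open_Collect_neq continuous_intros)+
  ultimately have oW: "open W" unfolding W_def using W1(1) by blast
  have bl: "bounded_linear (\<lambda>q :: R5. fst q)" "bounded_linear (\<lambda>q :: R5. fst (snd q))" "bounded_linear (\<lambda>q :: R5. snd (snd q))"
    by (intro bounded_linear_fst bounded_linear_snd bounded_linear_fst_comp bounded_linear_snd_comp)+
  have "smooth_on W \<eta>" unfolding \<eta>_def[abs_def]
    by (intro smooth_on_add smooth_on_mult smooth_on_const smooth_on_norm_vec2 oW bl smooth_on_bounded_linear)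
       (auto simp: W_def)
  then have sm: "smooth_on W (\<lambda>q. g (\<eta> q))"
    by (intro smooth_on_compose[OF oW _ _ d(3)]) (auto simp: W_def)
  have p0: "fst (orbit_pt s u v) \<noteq> 0" "fst (snd (orbit_pt s u v)) \<noteq> 0" for s u v
    using orbit_pt_components[of s u v] pos[of s] by auto
  show thesis
  proof (rule that[OF oW _ sm])
    have "orbit_pt s0 u0 v0 \<in> W1" using W1 \<open>w0 \<in> U\<close> p by blast
    then show "orbit_pt s0 u0 v0 \<in> W" using p0 d(1) unfolding W_def by (auto simp: \<eta>)
    show "g (\<eta> (orbit_pt s0 u0 v0)) = s0" using d by (simp add: \<eta>)
    show "\<exists>u v. q = orbit_pt (g (\<eta> q)) u v" if q: "q \<in> hypersurface \<inter> W" for q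
    proof -
      obtain w where w: "w \<in> U" "q = \<Phi> w" using q W1 by (auto simp: W_def)
      then have "g (\<eta> q) = w $ 1" using U d(4) by (simp add: \<Phi>_def \<eta>)
      then show ?thesis using w by (auto simp: \<Phi>_def)
    qed
  qed
qed

text \<open>
  The choice of a parameter \<open>s\<close> makes the field a function of the ambient point; its value on the
  hypersurface does not depend on the choice, since the normal of the profile curve is periodic.
\<close>

definition normal :: "R5 \<Rightarrow> R5" where
  "normal p = (let s = SOME s. X s = norm (fst p) \<and> Y s = norm (fst (snd p)) \<and> Z s = snd (snd p)
     in ((n1 s / X s) *\<^sub>R fst p, (n2 s / Y s) *\<^sub>R fst (snd p), n3 s))"

lemma normal_orbit_pt: "normal (orbit_pt s u v) = orbit_normal s u v"
proof -
  define s' where "s' = (SOME s'. X s' = X s \<and> Y s' = Y s \<and> Z s' = Z s)"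
  have s': "X s' = X s \<and> Y s' = Y s \<and> Z s' = Z s" unfolding s'_def by (rule someI[of _ s]) simp
  then obtain k :: int where "s' = s + of_int k * L" using simple[of s s'] by auto
  then have "n1 s' = n1 s" "n2 s' = n2 s" "n3 s' = n3 s"
    using periodic_of_int[of n1, OF periodic(4)] periodic_of_int[of n2, OF periodic(5)]
      periodic_of_int[of n3, OF periodic(6)] by auto
  then show ?thesis
    unfolding normal_def orbit_pt_components s'_def[symmetric] Let_def
    using s' pos[of s] by (simp add: orbit_normal_def orbit_pt_def torus_vec_def)
qed

lemma normal_extends_smoothly:
  assumes "p \<in> hypersurface"
  obtains W F where "open W" "p \<in> W" "smooth_on W F" "\<And>q. q \<in> hypersurface \<inter> W \<Longrightarrow> F q = normal q"
proof -
  obtain s0 u0 v0 where p: "p = orbit_pt s0 u0 v0" using assms by (rule hypersurfaceE)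
  obtain W \<sigma> where W: "open W" "p \<in> W" and \<sigma>: "smooth_on W \<sigma>"
    and q: "\<And>q. q \<in> hypersurface \<inter> W \<Longrightarrow> \<exists>u v. q = orbit_pt (\<sigma> q) u v"
    using parameter_extends_smoothly unfolding p by metis
  define F where "F q = (n1 (\<sigma> q) * inverse (X (\<sigma> q))) *\<^sub>R (fst q, 0, 0) +
     ((n2 (\<sigma> q) * inverse (Y (\<sigma> q))) *\<^sub>R (0, fst (snd q), 0) + n3 (\<sigma> q) *\<^sub>R (0, 0, 1::real))" for q :: R5
  have c: "smooth_on W (\<lambda>q. f (\<sigma> q))" if "smooth_on UNIV f" for f :: "real \<Rightarrow> real"
    by (rule smooth_on_compose[OF W(1) subset_UNIV \<sigma> that])
  have ne: "X s \<noteq> 0" "Y s \<noteq> 0" for s using pos[of s] by auto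
  have bl: "bounded_linear (\<lambda>q. (fst q, 0, 0) :: R5)" "bounded_linear (\<lambda>q. (0, fst (snd q), 0) :: R5)"
    by (intro bounded_linear_Pair bounded_linear_zero bounded_linear_fst bounded_linear_fst_comp bounded_linear_snd)+
  have "smooth_on W F" unfolding F_def[abs_def]
    by (intro smooth_on_add smooth_on_scaleR smooth_on_mult smooth_on_const smooth_on_inverse_fun c
        smooth W(1) ne smooth_on_bounded_linear bl)
  moreover have "F q = normal q" if qW: "q \<in> hypersurface \<inter> W" for q
  proof -
    obtain u v where quv: "q = orbit_pt (\<sigma> q) u v" using q[OF qW] by blast
    have "fst (orbit_pt s u v) = X s *\<^sub>R circle_pt u" "fst (snd (orbit_pt s u v)) = Y s *\<^sub>R circle_pt v" for s
      by (simp_all add: orbit_pt_def torus_vec_def)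
    then have "normal q = orbit_normal (\<sigma> q) u v" "fst q = X (\<sigma> q) *\<^sub>R circle_pt u" "fst (snd q) = Y (\<sigma> q) *\<^sub>R circle_pt v"
      using normal_orbit_pt[of "\<sigma> q" u v] quv by metis+
    then show ?thesis using pos[of "\<sigma> q"] by (simp add: F_def orbit_normal_def torus_vec_def)
  qed
  ultimately show thesis using that W by blast
qed

text \<open>
  A combination of the frame is the velocity of a curve with affine parameters. Conversely, the
  parameter \<open>\<sigma>\<close> along a curve in the hypersurface is differentiable, and differentiating \<open>|P|\<^sup>2 = X\<^sup>2\<close>, \<open>|Q|\<^sup>2 = Y\<^sup>2\<close> and
  \<open>c = Z\<close> leaves only the components along the circles undetermined.
\<close>

lemma tangent_space_hypersurface: "tangent_space hypersurface (orbit_pt s u v) = span {orbit_tangent s u v, (circle_tangent u, 0, 0), (0, circle_tangent v, 0)}"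
proof (intro equalityI subsetI)
  fix x assume "x \<in> span {orbit_tangent s u v, (circle_tangent u, 0, 0), (0, circle_tangent v, 0)}"
  then obtain a b c where x: "x = a *\<^sub>R orbit_tangent s u v + b *\<^sub>R (circle_tangent u, 0, 0) + c *\<^sub>R (0, circle_tangent v, 0)"
    by (auto simp: span_breakdown_eq algebra_simps simp del: scaleR_Pair)
  define \<gamma> where "\<gamma> \<tau> = orbit_pt (s + \<tau> * a) (u + \<tau> * (b / X s)) (v + \<tau> * (c / Y s))" for \<tau>
  have lin: "smooth_on {-1<..<1} (\<lambda>\<tau>. x + \<tau> * y)" for x y :: real
    by (intro smooth_on_add smooth_on_const smooth_on_bounded_linear bounded_linear_mult_left open_greaterThanLessThan)
  have "smooth_on {-1<..<1} \<gamma>" unfolding \<gamma>_def[abs_def] orbit_pt_def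
    by (intro smooth_on_torus_vec lin smooth_on_compose[OF _ subset_UNIV lin] smooth open_greaterThanLessThan)
  moreover have "(\<gamma> has_vector_derivative x) (at 0)"
    using coordinate_curve_has_vector_derivative[OF D(1) D(2) D(3), of s a u "b / X s" v "c / Y s"] pos[of s]
    by (simp add: \<gamma>_def[abs_def] orbit_pt_def x orbit_tangent_def del: scaleR_Pair)
  moreover have "\<gamma> ` {-1<..<1} \<subseteq> hypersurface" by (auto simp: \<gamma>_def orbit_pt_in_hypersurface)
  ultimately show "x \<in> tangent_space hypersurface (orbit_pt s u v)"
    unfolding tangent_space_def by (intro CollectI exI[of _ 1] conjI exI[of _ \<gamma>]) (auto simp: \<gamma>_def)
next
  fix x assume "x \<in> tangent_space hypersurface (orbit_pt s u v)"
  then obtain e \<gamma> where e: "e > 0" "\<gamma> ` {-e<..<e} \<subseteq> hypersurface" "\<gamma> 0 = orbit_pt s u v"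
    and D\<gamma>: "(\<gamma> has_vector_derivative x) (at 0)"
    unfolding tangent_space_def by blast
  obtain W \<sigma> where W: "open W" "orbit_pt s u v \<in> W" and \<sigma>: "smooth_on W \<sigma>" "\<sigma> (orbit_pt s u v) = s"
    and q: "\<And>q. q \<in> hypersurface \<inter> W \<Longrightarrow> \<exists>u v. q = orbit_pt (\<sigma> q) u v"
    using parameter_extends_smoothly by metis
  have D\<gamma>': "(\<gamma> has_derivative (\<lambda>h. h *\<^sub>R x)) (at 0)" using D\<gamma> by (simp add: has_vector_derivative_def)
  obtain \<sigma>' where \<sigma>': "(\<sigma> has_derivative \<sigma>') (at (\<gamma> 0))"
    using smooth_on_differentiable[OF \<sigma>(1) W(2)] e(3) by (auto simp: differentiable_def)
  define k where "k = \<sigma>' x"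
  have "((\<lambda>\<tau>. \<sigma> (\<gamma> \<tau>)) has_derivative (\<lambda>h. \<sigma>' (h *\<^sub>R x))) (at 0)"
    by (rule has_derivative_compose[OF D\<gamma>' \<sigma>'])
  moreover have "(\<lambda>h. \<sigma>' (h *\<^sub>R x)) = (*) k"
    using linear_scale[OF has_derivative_linear[OF \<sigma>']] by (auto simp: fun_eq_iff k_def)
  ultimately have D\<sigma>: "((\<lambda>\<tau>. \<sigma> (\<gamma> \<tau>)) has_real_derivative k) (at 0)"
    by (simp add: has_field_derivative_def)
  have "continuous (at 0) \<gamma>" using D\<gamma>' by (rule has_derivative_continuous)
  then have "(\<gamma> \<longlongrightarrow> \<gamma> 0) (nhds 0)" by (simp add: continuous_within tendsto_at_iff_tendsto_nhds)
  then have "\<forall>\<^sub>F \<tau> in nhds 0. \<gamma> \<tau> \<in> W"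
    by (rule topological_tendstoD) (use W e(3) in auto)
  moreover have "\<forall>\<^sub>F \<tau> in nhds (0::real). \<tau> \<in> {-e<..<e}"
    using e(1) by (intro eventually_nhds_in_open) auto
  ultimately have ev: "\<forall>\<^sub>F \<tau> in nhds 0. \<gamma> \<tau> \<in> hypersurface \<inter> W"
    by eventually_elim (use e(2) in auto)
  have comp: "\<phi>' x = g * k" if \<phi>: "\<And>s u v. \<phi> (orbit_pt s u v) = G s" "(\<phi> has_derivative \<phi>') (at (orbit_pt s u v))"
    and G: "(G has_real_derivative g) (at s)" for \<phi> :: "R5 \<Rightarrow> real" and \<phi>' G g
  proof -
    have 1: "((\<lambda>\<tau>. \<phi> (\<gamma> \<tau>)) has_derivative (\<lambda>h. \<phi>' (h *\<^sub>R x))) (at 0)"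
      by (rule has_derivative_compose[OF D\<gamma>']) (simp add: e(3) \<phi>(2))
    have 2: "((\<lambda>\<tau>. G (\<sigma> (\<gamma> \<tau>))) has_real_derivative g * k) (at 0)"
      by (rule DERIV_chain2[OF _ D\<sigma>]) (simp add: e(3) \<sigma>(2) G)
    have 3: "\<forall>\<^sub>F \<tau> in nhds 0. G (\<sigma> (\<gamma> \<tau>)) = \<phi> (\<gamma> \<tau>)"
      using ev
    proof eventually_elim
      case (elim \<tau>)
      then obtain u v where "\<gamma> \<tau> = orbit_pt (\<sigma> (\<gamma> \<tau>)) u v" using q by blast
      then show ?case using \<phi>(1) by metis
    qed
    have "((\<lambda>\<tau>. \<phi> (\<gamma> \<tau>)) has_real_derivative g * k) (at 0)"
      by (rule iffD1[OF DERIV_cong_ev[OF refl 3 refl] 2])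
    from has_derivative_unique[OF 1 this[unfolded has_field_derivative_def]]
    show ?thesis by (metis mult.right_neutral scaleR_one)
  qed
  have fp: "fst (orbit_pt s u v) = X s *\<^sub>R circle_pt u" "fst (snd (orbit_pt s u v)) = Y s *\<^sub>R circle_pt v" for s u v
    by (simp_all add: orbit_pt_def torus_vec_def)
  have "2 * (X s * (circle_pt u \<bullet> fst x)) = 2 * X s * X' s * k"
    by (rule comp[where \<phi> = "\<lambda>q. fst q \<bullet> fst q" and G = "\<lambda>s. X s * X s"])
       (auto intro!: derivative_eq_intros D simp: fp inner_commute)
  then have x1: "fst x \<bullet> circle_pt u = k * X' s" using pos[of s] by (simp add: inner_commute)
  have "2 * (Y s * (circle_pt v \<bullet> fst (snd x))) = 2 * Y s * Y' s * k"
    by (rule comp[where \<phi> = "\<lambda>q. fst (snd q) \<bullet> fst (snd q)" and G = "\<lambda>s. Y s * Y s"])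
       (auto intro!: derivative_eq_intros D simp: fp inner_commute)
  then have x2: "fst (snd x) \<bullet> circle_pt v = k * Y' s" using pos[of s] by (simp add: inner_commute)
  have x3: "snd (snd x) = Z' s * k"
    by (rule comp[where \<phi> = "\<lambda>q. snd (snd q)" and G = Z])
       (auto intro!: derivative_eq_intros D simp: orbit_pt_components)
  have "x = (fst x, fst (snd x), snd (snd x))" by simp
  also have "\<dots> = k *\<^sub>R orbit_tangent s u v + (fst x \<bullet> circle_tangent u) *\<^sub>R (circle_tangent u, 0, 0) + (fst (snd x) \<bullet> circle_tangent v) *\<^sub>R (0, circle_tangent v, 0)"
    using circle_frame_expansion[of "fst x" u] circle_frame_expansion[of "fst (snd x)" v]
    by (simp add: orbit_tangent_def torus_vec_def x1 x2 x3 mult.commute)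
  also have "\<dots> \<in> span {orbit_tangent s u v, (circle_tangent u, 0, 0), (0, circle_tangent v, 0)}"
    by (intro span_add span_scale span_base) auto
  finally show "x \<in> span {orbit_tangent s u v, (circle_tangent u, 0, 0), (0, circle_tangent v, 0)}" .
qed

lemma unit_normal: "unit_normal_field hypersurface normal"
  unfolding unit_normal_field_def
proof (intro conjI ballI)
  show "smooth_along hypersurface normal"
    unfolding smooth_along_def using normal_extends_smoothly by metis
next
  fix p assume "p \<in> hypersurface"
  then obtain s u v where p: "p = orbit_pt s u v" by (rule hypersurfaceE)
  show 1: "norm (normal p) = 1" by (simp add: p normal_orbit_pt norm_eq_sqrt_inner)
  show "normal p \<in> tangent_space (sphere 0 1) p"
    by (rule tangent_space_sphere[OF _ 1]) (simp_all add: p normal_orbit_pt norm_eq_sqrt_inner)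
  fix x assume "x \<in> tangent_space hypersurface p"
  then have "x \<in> span {orbit_tangent s u v, (circle_tangent u, 0, 0), (0, circle_tangent v, 0)}" by (simp only: p tangent_space_hypersurface)
  then have "orthogonal (orbit_normal s u v) x"
    by (rule orthogonal_to_span) (auto simp: orthogonal_def)
  then show "normal p \<bullet> x = 0" by (simp add: orthogonal_def p normal_orbit_pt)
qed

text \<open>
  A derivative of the normal field within the hypersurface is determined on tangent vectors only, where the
  chain rule along coordinate curves computes it: the frame consists of eigenvectors.
\<close>

lemma mean_curvature_hypersurface: "mean_curvature hypersurface normal (orbit_pt s u v) = \<kappa> s - n1 s / X s - n2 s / Y s"
proof -
  define p where "p = orbit_pt s u v"
  define D where "D = frechet_derivative normal (at p within hypersurface)"
  have p: "p \<in> hypersurface" by (simp add: p_def orbit_pt_in_hypersurface)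
  obtain W F where W: "open W" "p \<in> W" "smooth_on W F" "\<And>q. q \<in> hypersurface \<inter> W \<Longrightarrow> F q = normal q"
    using normal_extends_smoothly[OF p] by metis
  have "F differentiable (at p within hypersurface)"
    using smooth_on_differentiable[OF W(3,2)] differentiable_at_withinI by blast
  moreover obtain d where "d > 0" "ball p d \<subseteq> W" using W(1,2) open_contains_ball by blast
  moreover from this have "F q = normal q" if "q \<in> hypersurface" "dist q p < d" for q
  proof -
    have "q \<in> ball p d" using that(2) by (simp add: dist_commute)
    then show ?thesis using W(4)[of q] that(1) \<open>ball p d \<subseteq> W\<close> by blast
  qed
  ultimately have "normal differentiable (at p within hypersurface)"
    using p differentiable_transform_within by metis
  then have DN: "(normal has_derivative D) (at p within hypersurface)"
    unfolding D_def frechet_derivative_works .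
  then have linD: "linear D" by (rule has_derivative_linear)
  have Deq: "D (a *\<^sub>R orbit_tangent s u v + (X s * b) *\<^sub>R (circle_tangent u, 0, 0) + (Y s * c) *\<^sub>R (0, circle_tangent v, 0)) =
      a *\<^sub>R (- \<kappa> s) *\<^sub>R orbit_tangent s u v + (n1 s * b) *\<^sub>R (circle_tangent u, 0, 0) + (n2 s * c) *\<^sub>R (0, circle_tangent v, 0)" (is "D ?x = ?y")
    for a b c
  proof -
    define \<gamma> where "\<gamma> \<tau> = orbit_pt (s + \<tau> * a) (u + \<tau> * b) (v + \<tau> * c)" for \<tau>
    have \<gamma>: "(\<gamma> has_derivative (\<lambda>h. h *\<^sub>R ?x)) (at 0)"
      using coordinate_curve_has_vector_derivative[OF D(1) D(2) D(3)]
      by (simp only: \<gamma>_def[abs_def] orbit_pt_def orbit_tangent_def has_vector_derivative_def)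
    have "((\<lambda>\<tau>. normal (\<gamma> \<tau>)) has_derivative (\<lambda>h. D (h *\<^sub>R ?x))) (at 0)"
    proof (rule has_derivative_in_compose[OF \<gamma>])
      have "\<gamma> 0 = p" "range \<gamma> \<subseteq> hypersurface" by (auto simp: \<gamma>_def p_def orbit_pt_in_hypersurface)
      then show "(normal has_derivative D) (at (\<gamma> 0) within range \<gamma>)"
        using has_derivative_subset[OF DN] by simp
    qed
    moreover have "((\<lambda>\<tau>. normal (\<gamma> \<tau>)) has_derivative (\<lambda>h. h *\<^sub>R ?y)) (at 0)"
      using coordinate_curve_has_vector_derivative[OF Dn(1) Dn(2) Dn(3)]
      by (simp only: \<gamma>_def[abs_def] normal_orbit_pt orbit_normal_def orbit_tangent_def has_vector_derivative_def torus_vec_scaleR)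
    ultimately have "(\<lambda>h. D (h *\<^sub>R ?x)) = (\<lambda>h. h *\<^sub>R ?y)" by (rule has_derivative_unique)
    from fun_cong[OF this, of 1] show ?thesis by (simp only: scaleR_one)
  qed
  have D1: "D (orbit_tangent s u v) = (- \<kappa> s) *\<^sub>R orbit_tangent s u v" using Deq[of 1 0 0] by (simp del: scaleR_Pair)
  have D2: "D (circle_tangent u, 0, 0) = (n1 s / X s) *\<^sub>R (circle_tangent u, 0, 0)"
    using Deq[of 0 "1 / X s" 0] pos[of s] by (simp del: scaleR_Pair)
  have D3: "D (0, circle_tangent v, 0) = (n2 s / Y s) *\<^sub>R (0, circle_tangent v, 0)"
    using Deq[of 0 0 "1 / Y s"] pos[of s] by (simp del: scaleR_Pair)
  define A where "A = shape_operator hypersurface normal p"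
  have A: "A x = - (D x - (D x \<bullet> p) *\<^sub>R p)" for x
    by (simp add: A_def shape_operator_def D_def Let_def)
  have linA: "linear A"
    by (rule linearI) (simp_all add: A linear_add[OF linD] linear_scale[OF linD] inner_add_left algebra_simps)
  let ?B = "{orbit_tangent s u v, (circle_tangent u, 0, 0), (0, circle_tangent v, 0)}"
  have B: "orthonormal_basis (tangent_space hypersurface p) ?B"
    unfolding orthonormal_basis_def p_def tangent_space_hypersurface
    by (auto simp: pairwise_insert orthogonal_def norm_eq_sqrt_inner)
  have ne: "orbit_tangent s u v \<noteq> (circle_tangent u, 0, 0)" "orbit_tangent s u v \<noteq> (0, circle_tangent v, 0)" "(circle_tangent u, 0, 0) \<noteq> ((0, circle_tangent v, 0) :: R5)"
    using frame_inner perp_inner by (metis zero_neq_one)+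
  have "mean_curvature hypersurface normal p = (\<Sum>b\<in>?B. A b \<bullet> b)"
    unfolding mean_curvature_def A_def[symmetric] by (rule trace_on_eq[OF linA B])
  also have "\<dots> = A (orbit_tangent s u v) \<bullet> orbit_tangent s u v + (A (circle_tangent u, 0, 0) \<bullet> (circle_tangent u, 0, 0) + A (0, circle_tangent v, 0) \<bullet> (0, circle_tangent v, 0))"
    using ne by simp
  also have "\<dots> = \<kappa> s - n1 s / X s - n2 s / Y s"
    unfolding A D1 D2 D3 p_def
    by (simp add: inner_diff_left del: scaleR_Pair)
  finally show ?thesis by (simp add: p_def)
qed

end

section \<open>Uniqueness and gluing of solutions of the profile equations\<close>

definition turning :: "real \<Rightarrow> real \<Rightarrow> real \<Rightarrow> real" where
  "turning \<rho> \<phi> \<psi> = 2 * cot (2 * \<phi>) / sin \<rho> * cos \<psi> - 3 * cot \<rho> * sin \<psi> - 3"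

text \<open>
  The profile equations without the initial condition, which reflected solutions need not satisfy.
\<close>

definition profile_flow :: "real set \<Rightarrow> (real \<Rightarrow> real) \<Rightarrow> (real \<Rightarrow> real) \<Rightarrow> (real \<Rightarrow> real) \<Rightarrow> bool" where
  "profile_flow J r \<theta> \<alpha> \<longleftrightarrow>
     (\<forall>s\<in>J. sin (r s) \<noteq> 0 \<and> sin (2 * \<theta> s) \<noteq> 0 \<and>
        (r has_real_derivative cos (\<alpha> s)) (at s within J) \<and>
        (\<theta> has_real_derivative sin (\<alpha> s) / sin (r s)) (at s within J) \<and>
        (\<alpha> has_real_derivative turning (r s) (\<theta> s) (\<alpha> s)) (at s within J))"

lemma profile_solution_iff:
  "profile_solution a J r \<theta> \<alpha> \<longleftrightarrow>
     is_interval J \<and> 0 \<in> J \<and> r 0 = pi / 2 \<and> \<theta> 0 = a \<and> \<alpha> 0 = pi \<and> profile_flow J r \<theta> \<alpha>"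
  by (simp add: profile_solution_def profile_flow_def turning_def)

lemma profile_flowD:
  assumes "profile_flow J r \<theta> \<alpha>" "s \<in> J"
  shows "sin (r s) \<noteq> 0" "sin (2 * \<theta> s) \<noteq> 0"
    "(r has_real_derivative cos (\<alpha> s)) (at s within J)"
    "(\<theta> has_real_derivative sin (\<alpha> s) / sin (r s)) (at s within J)"
    "(\<alpha> has_real_derivative turning (r s) (\<theta> s) (\<alpha> s)) (at s within J)"
  using assms unfolding profile_flow_def by blast+

lemma profile_flow_subset: "profile_flow J r \<theta> \<alpha> \<Longrightarrow> I \<subseteq> J \<Longrightarrow> profile_flow I r \<theta> \<alpha>"
  unfolding profile_flow_def by (meson DERIV_subset subsetD)

text \<open>
  Bounded functions whose difference is controlled by \<open>\<delta>\<close>. This relation is preserved by the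
  operations from which the right-hand sides of the profile equations are built, which gives their
  Lipschitz estimate along two solutions term by term.
\<close>

definition lip_close :: "real set \<Rightarrow> (real \<Rightarrow> real) \<Rightarrow> (real \<Rightarrow> real) \<Rightarrow> (real \<Rightarrow> real) \<Rightarrow> bool" where
  "lip_close I \<delta> f g \<longleftrightarrow> (\<exists>K\<ge>0. \<forall>x\<in>I. \<bar>f x\<bar> \<le> K \<and> \<bar>g x\<bar> \<le> K \<and> \<bar>f x - g x\<bar> \<le> K * \<delta> x)"

lemma lip_close_const: assumes "\<And>x. x \<in> I \<Longrightarrow> \<delta> x \<ge> 0" shows "lip_close I \<delta> (\<lambda>x. c) (\<lambda>x. c)"
  unfolding lip_close_def using assms by (intro exI[of _ "\<bar>c\<bar>"]) auto

lemma lip_close_diff: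
  assumes "lip_close I \<delta> f g" "lip_close I \<delta> f' g'"
  shows "lip_close I \<delta> (\<lambda>x. f x - f' x) (\<lambda>x. g x - g' x)"
proof -
  obtain K where K: "K \<ge> 0" "\<And>x. x \<in> I \<Longrightarrow> \<bar>f x\<bar> \<le> K \<and> \<bar>g x\<bar> \<le> K \<and> \<bar>f x - g x\<bar> \<le> K * \<delta> x"
    using assms(1) by (auto simp: lip_close_def)
  obtain K' where K': "K' \<ge> 0" "\<And>x. x \<in> I \<Longrightarrow> \<bar>f' x\<bar> \<le> K' \<and> \<bar>g' x\<bar> \<le> K' \<and> \<bar>f' x - g' x\<bar> \<le> K' * \<delta> x"
    using assms(2) by (auto simp: lip_close_def)
  show ?thesis
    unfolding lip_close_def
  proof (intro exI[of _ "K + K'"] conjI ballI)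
    fix x assume "x \<in> I"
    from K(2)[OF this] K'(2)[OF this]
    show "\<bar>f x - f' x\<bar> \<le> K + K'" "\<bar>g x - g' x\<bar> \<le> K + K'"
      "\<bar>f x - f' x - (g x - g' x)\<bar> \<le> (K + K') * \<delta> x"
      unfolding distrib_right by linarith+
  qed (use K K' in simp)
qed

lemma lip_close_mult:
  assumes "lip_close I \<delta> f g" "lip_close I \<delta> f' g'"
  shows "lip_close I \<delta> (\<lambda>x. f x * f' x) (\<lambda>x. g x * g' x)"
proof -
  obtain K where K: "K \<ge> 0" "\<And>x. x \<in> I \<Longrightarrow> \<bar>f x\<bar> \<le> K \<and> \<bar>g x\<bar> \<le> K \<and> \<bar>f x - g x\<bar> \<le> K * \<delta> x"
    using assms(1) by (auto simp: lip_close_def)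
  obtain K' where K': "K' \<ge> 0" "\<And>x. x \<in> I \<Longrightarrow> \<bar>f' x\<bar> \<le> K' \<and> \<bar>g' x\<bar> \<le> K' \<and> \<bar>f' x - g' x\<bar> \<le> K' * \<delta> x"
    using assms(2) by (auto simp: lip_close_def)
  show ?thesis
    unfolding lip_close_def
  proof (intro exI[of _ "2 * (K * K')"] conjI ballI)
    fix x assume x: "x \<in> I"
    note k = K(2)[OF x] and k' = K'(2)[OF x]
    have p: "0 \<le> K * K'" using K K' by simp
    have "\<bar>f x\<bar> * \<bar>f' x\<bar> \<le> K * K'" "\<bar>g x\<bar> * \<bar>g' x\<bar> \<le> K * K'"
      using k k' K K' by (auto intro!: mult_mono)
    then show "\<bar>f x * f' x\<bar> \<le> 2 * (K * K')" "\<bar>g x * g' x\<bar> \<le> 2 * (K * K')"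
      using p unfolding abs_mult by linarith+
    have "f x * f' x - g x * g' x = f x * (f' x - g' x) + (f x - g x) * g' x" by algebra
    then have "\<bar>f x * f' x - g x * g' x\<bar> \<le> \<bar>f x\<bar> * \<bar>f' x - g' x\<bar> + \<bar>f x - g x\<bar> * \<bar>g' x\<bar>"
      by (metis abs_mult abs_triangle_ineq)
    also have "\<dots> \<le> K * (K' * \<delta> x) + (K * \<delta> x) * K'"
      using k k' K K' by (intro add_mono mult_mono) auto
    finally show "\<bar>f x * f' x - g x * g' x\<bar> \<le> 2 * (K * K') * \<delta> x" by (simp add: mult_ac)
  qed (use K K' in simp)
qed

lemma lip_close_sin_cos:
  assumes "\<And>x. x \<in> I \<Longrightarrow> \<bar>f x - g x\<bar> \<le> K * \<delta> x" "\<And>x. x \<in> I \<Longrightarrow> \<delta> x \<ge> 0" "K \<ge> 0"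
  shows "lip_close I \<delta> (\<lambda>x. sin (f x)) (\<lambda>x. sin (g x))" "lip_close I \<delta> (\<lambda>x. cos (f x)) (\<lambda>x. cos (g x))"
proof -
  have s: "\<bar>sin a - sin b\<bar> \<le> \<bar>a - b\<bar>" for a b :: real
  proof -
    have "\<bar>sin a - sin b\<bar> = 2 * \<bar>sin ((a - b) / 2)\<bar> * \<bar>cos ((a + b) / 2)\<bar>"
      by (simp add: sin_diff_sin abs_mult)
    also have "\<dots> \<le> 2 * \<bar>(a - b) / 2\<bar> * 1"
      by (intro mult_mono abs_sin_x_le_abs_x) auto
    finally show ?thesis by simp
  qed
  have c: "\<bar>cos a - cos b\<bar> \<le> \<bar>a - b\<bar>" for a b :: real
    using s[of "pi / 2 - a" "pi / 2 - b"] by (simp add: cos_sin_eq abs_minus_commute)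
  have "\<bar>f x - g x\<bar> \<le> (1 + K) * \<delta> x" if "x \<in> I" for x
    using assms(1,2)[OF that] by (simp add: distrib_right)
  then have "\<bar>sin (f x) - sin (g x)\<bar> \<le> (1 + K) * \<delta> x" "\<bar>cos (f x) - cos (g x)\<bar> \<le> (1 + K) * \<delta> x" if "x \<in> I" for x
    using that s[of "f x" "g x"] c[of "f x" "g x"] order_trans by blast+
  moreover have "\<bar>sin y\<bar> \<le> 1 + K" "\<bar>cos y\<bar> \<le> 1 + K" for y :: real
    using abs_sin_le_one[of y] abs_cos_le_one[of y] assms(3) by linarith+
  ultimately show "lip_close I \<delta> (\<lambda>x. sin (f x)) (\<lambda>x. sin (g x))" "lip_close I \<delta> (\<lambda>x. cos (f x)) (\<lambda>x. cos (g x))"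
    unfolding lip_close_def using assms(3) by (intro exI[of _ "1 + K"]; simp)+
qed

text \<open>
  Compactness bounds the two denominators away from zero. The values of \<open>f\<close> and \<open>g\<close> are compared
  directly rather than by the mean value theorem, since zero may lie between them.
\<close>

lemma lip_close_inverse:
  assumes I: "compact I" "continuous_on I f" "continuous_on I g" "\<And>x. x \<in> I \<Longrightarrow> f x \<noteq> 0" "\<And>x. x \<in> I \<Longrightarrow> g x \<noteq> 0"
    and fg: "lip_close I \<delta> f g" and nn: "\<And>x. x \<in> I \<Longrightarrow> \<delta> x \<ge> 0"
  shows "lip_close I \<delta> (\<lambda>x. inverse (f x)) (\<lambda>x. inverse (g x))"
proof -
  obtain K where K: "K \<ge> 0" "\<And>x. x \<in> I \<Longrightarrow> \<bar>f x\<bar> \<le> K \<and> \<bar>g x\<bar> \<le> K \<and> \<bar>f x - g x\<bar> \<le> K * \<delta> x"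
    using fg by (auto simp: lip_close_def)
  have bd: "\<exists>B>0. \<forall>x\<in>I. \<bar>inverse (h x)\<bar> \<le> B" if "continuous_on I h" "\<And>x. x \<in> I \<Longrightarrow> h x \<noteq> 0" for h :: "real \<Rightarrow> real"
  proof -
    have "bounded ((\<lambda>x. inverse (h x)) ` I)"
      using that I(1) by (intro compact_imp_bounded compact_continuous_image continuous_on_inverse) auto
    then show ?thesis by (auto simp: bounded_pos)
  qed
  obtain B where B: "B > 0" "\<And>x. x \<in> I \<Longrightarrow> \<bar>inverse (f x)\<bar> \<le> B" using bd[OF I(2,4)] by blast
  obtain C where C: "C > 0" "\<And>x. x \<in> I \<Longrightarrow> \<bar>inverse (g x)\<bar> \<le> C" using bd[OF I(3,5)] by blast
  define M where "M = B + C + B * C * K"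
  have BCK: "0 \<le> B * C * K" using B C K by simp
  show ?thesis
    unfolding lip_close_def
  proof (intro exI[of _ M] conjI ballI)
    show "M \<ge> 0" using B C BCK by (simp add: M_def)
    fix x assume x: "x \<in> I"
    show "\<bar>inverse (f x)\<bar> \<le> M" "\<bar>inverse (g x)\<bar> \<le> M"
      using B(1) B(2)[OF x] C(1) C(2)[OF x] BCK unfolding M_def by linarith+
    have "inverse (f x) - inverse (g x) = inverse (f x) * inverse (g x) * (g x - f x)"
      using I(4,5)[OF x] by (simp add: field_simps)
    then have "\<bar>inverse (f x) - inverse (g x)\<bar> = \<bar>inverse (f x)\<bar> * \<bar>inverse (g x)\<bar> * \<bar>f x - g x\<bar>"
      by (simp add: abs_mult abs_minus_commute)
    also have "\<dots> \<le> B * C * (K * \<delta> x)"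
      using B(1) B(2)[OF x] C(1) C(2)[OF x] K(2)[OF x] by (intro mult_mono) auto
    also have "\<dots> \<le> M * \<delta> x"
      using mult_right_mono[OF _ nn[OF x], of "B * C * K" M] B(1) C(1) by (simp add: M_def mult_ac)
    finally show "\<bar>inverse (f x) - inverse (g x)\<bar> \<le> M * \<delta> x" .
  qed
qed

text \<open>
  Gronwall's argument: \<open>d x * exp (- C * x)\<close> is nonincreasing and \<open>d x * exp (C * x)\<close> is nondecreasing.
  One of them serves forward from the left end, the other backward from the right end.
\<close>

lemma zero_of_abs_deriv_le:
  fixes d :: "real \<Rightarrow> real"
  assumes D: "\<And>x. x \<in> {a..b} \<Longrightarrow> (d has_real_derivative d' x) (at x within {a..b})"
    and le: "\<And>x. x \<in> {a..b} \<Longrightarrow> \<bar>d' x\<bar> \<le> C * d x" and nn: "\<And>x. d x \<ge> 0"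
    and c: "c = a \<or> c = b" "d c = 0" and x: "x \<in> {a..b}"
  shows "d x = 0"
proof -
  have cont: "continuous_on {a..b} d"
    using D by (meson DERIV_continuous_on)
  have Dat: "(d has_real_derivative d' x) (at x)" if "a < x" "x < b" for x
    using D[of x] that at_within_Icc_at[of a x b] by simp
  show ?thesis using c(1)
  proof
    assume "c = a"
    have "d x * exp (- C * x) \<le> d a * exp (- C * a)"
    proof (rule DERIV_nonpos_imp_decreasing_open[of a x "\<lambda>x. d x * exp (- C * x)"])
      fix y assume y: "a < y" "y < x"
      have "((\<lambda>x. d x * exp (- C * x)) has_real_derivative (d' y - C * d y) * exp (- C * y)) (at y)"
        using y x by (auto intro!: derivative_eq_intros Dat simp: algebra_simps)
      moreover have "(d' y - C * d y) * exp (- C * y) \<le> 0"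
        using le[of y] y x by (intro mult_nonpos_nonneg) auto
      ultimately show "\<exists>z. ((\<lambda>x. d x * exp (- C * x)) has_real_derivative z) (at y) \<and> z \<le> 0" by blast
    qed (use x cont in \<open>auto intro!: continuous_intros intro: continuous_on_subset\<close>)
    then have "d x * exp (- C * x) \<le> 0" using c \<open>c = a\<close> by simp
    then show ?thesis using nn[of x] by (simp add: mult_le_0_iff)
  next
    assume "c = b"
    have "d x * exp (C * x) \<le> d b * exp (C * b)"
    proof (rule DERIV_nonneg_imp_increasing_open[of x b "\<lambda>x. d x * exp (C * x)"])
      fix y assume y: "x < y" "y < b"
      have "((\<lambda>x. d x * exp (C * x)) has_real_derivative (d' y + C * d y) * exp (C * y)) (at y)"
        using y x by (auto intro!: derivative_eq_intros Dat simp: algebra_simps)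
      moreover have "(d' y + C * d y) * exp (C * y) \<ge> 0"
        using le[of y] y x by (intro mult_nonneg_nonneg) auto
      ultimately show "\<exists>z. ((\<lambda>x. d x * exp (C * x)) has_real_derivative z) (at y) \<and> 0 \<le> z" by blast
    qed (use x cont in \<open>auto intro!: continuous_intros intro: continuous_on_subset\<close>)
    then have "d x * exp (C * x) \<le> 0" using c \<open>c = b\<close> by simp
    then show ?thesis using nn[of x] by (simp add: mult_le_0_iff)
  qed
qed

lemma profile_flow_lip_close:
  assumes f1: "profile_flow {a..b} r1 \<theta>1 \<alpha>1" and f2: "profile_flow {a..b} r2 \<theta>2 \<alpha>2"
  defines "\<delta> \<equiv> \<lambda>x. \<bar>r1 x - r2 x\<bar> + \<bar>\<theta>1 x - \<theta>2 x\<bar> + \<bar>\<alpha>1 x - \<alpha>2 x\<bar>"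
  shows "lip_close {a..b} \<delta> (\<lambda>s. cos (\<alpha>1 s)) (\<lambda>s. cos (\<alpha>2 s))"
    "lip_close {a..b} \<delta> (\<lambda>s. sin (\<alpha>1 s) / sin (r1 s)) (\<lambda>s. sin (\<alpha>2 s) / sin (r2 s))"
    "lip_close {a..b} \<delta> (\<lambda>s. turning (r1 s) (\<theta>1 s) (\<alpha>1 s)) (\<lambda>s. turning (r2 s) (\<theta>2 s) (\<alpha>2 s))"
proof -
  have cont: "continuous_on {a..b} r" "continuous_on {a..b} \<theta>" "continuous_on {a..b} \<alpha>"
    if "profile_flow {a..b} r \<theta> \<alpha>" for r \<theta> \<alpha>
    by (rule DERIV_continuous_on, erule profile_flowD[OF that])+
  have nz: "sin (r x) \<noteq> 0" "sin (2 * \<theta> x) \<noteq> 0" if "profile_flow {a..b} r \<theta> \<alpha>" "x \<in> {a..b}" for r \<theta> \<alpha> x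
    using profile_flowD(1,2)[OF that] .
  have nn: "\<delta> x \<ge> 0" for x by (simp add: \<delta>_def)
  have le: "\<bar>r1 x - r2 x\<bar> \<le> 1 * \<delta> x" "\<bar>2 * \<theta>1 x - 2 * \<theta>2 x\<bar> \<le> 2 * \<delta> x" "\<bar>\<alpha>1 x - \<alpha>2 x\<bar> \<le> 1 * \<delta> x" for x
  proof -
    have "\<bar>2 * \<theta>1 x - 2 * \<theta>2 x\<bar> = 2 * \<bar>\<theta>1 x - \<theta>2 x\<bar>"
      by (metis abs_mult abs_numeral right_diff_distrib)
    then show "\<bar>r1 x - r2 x\<bar> \<le> 1 * \<delta> x" "\<bar>2 * \<theta>1 x - 2 * \<theta>2 x\<bar> \<le> 2 * \<delta> x" "\<bar>\<alpha>1 x - \<alpha>2 x\<bar> \<le> 1 * \<delta> x"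
      by (simp_all add: \<delta>_def)
  qed
  have r: "lip_close {a..b} \<delta> (\<lambda>x. sin (r1 x)) (\<lambda>x. sin (r2 x))" "lip_close {a..b} \<delta> (\<lambda>x. cos (r1 x)) (\<lambda>x. cos (r2 x))"
    by (rule lip_close_sin_cos[OF le(1) nn], simp)+
  have \<theta>: "lip_close {a..b} \<delta> (\<lambda>x. sin (2 * \<theta>1 x)) (\<lambda>x. sin (2 * \<theta>2 x))" "lip_close {a..b} \<delta> (\<lambda>x. cos (2 * \<theta>1 x)) (\<lambda>x. cos (2 * \<theta>2 x))"
    by (rule lip_close_sin_cos[OF le(2) nn], simp)+
  have \<alpha>: "lip_close {a..b} \<delta> (\<lambda>x. sin (\<alpha>1 x)) (\<lambda>x. sin (\<alpha>2 x))" "lip_close {a..b} \<delta> (\<lambda>x. cos (\<alpha>1 x)) (\<lambda>x. cos (\<alpha>2 x))"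
    by (rule lip_close_sin_cos[OF le(3) nn], simp)+
  have ri: "lip_close {a..b} \<delta> (\<lambda>x. inverse (sin (r1 x))) (\<lambda>x. inverse (sin (r2 x)))"
  proof (rule lip_close_inverse)
    show "sin (r1 x) \<noteq> 0" "sin (r2 x) \<noteq> 0" if "x \<in> {a..b}" for x
      using nz(1)[OF f1 that] nz(1)[OF f2 that] .
    show "continuous_on {a..b} (\<lambda>x. sin (r1 x))" "continuous_on {a..b} (\<lambda>x. sin (r2 x))"
      by (intro continuous_on_sin cont(1)[OF f1] cont(1)[OF f2])+
  qed (rule compact_Icc r(1) nn)+
  have \<theta>i: "lip_close {a..b} \<delta> (\<lambda>x. inverse (sin (2 * \<theta>1 x))) (\<lambda>x. inverse (sin (2 * \<theta>2 x)))"
  proof (rule lip_close_inverse)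
    show "sin (2 * \<theta>1 x) \<noteq> 0" "sin (2 * \<theta>2 x) \<noteq> 0" if "x \<in> {a..b}" for x
      using nz(2)[OF f1 that] nz(2)[OF f2 that] .
    show "continuous_on {a..b} (\<lambda>x. sin (2 * \<theta>1 x))" "continuous_on {a..b} (\<lambda>x. sin (2 * \<theta>2 x))"
      by (intro continuous_on_sin continuous_on_mult_left cont(2)[OF f1] cont(2)[OF f2])+
  qed (rule compact_Icc \<theta>(1) nn)+
  show "lip_close {a..b} \<delta> (\<lambda>s. cos (\<alpha>1 s)) (\<lambda>s. cos (\<alpha>2 s))" by (rule \<alpha>)
  show "lip_close {a..b} \<delta> (\<lambda>s. sin (\<alpha>1 s) / sin (r1 s)) (\<lambda>s. sin (\<alpha>2 s) / sin (r2 s))"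
    unfolding divide_inverse by (rule lip_close_mult[OF \<alpha>(1) ri])
  have eq: "turning \<rho> \<phi> \<psi> = 2 * (cos (2 * \<phi>) * inverse (sin (2 * \<phi>))) * inverse (sin \<rho>) * cos \<psi>
       - 3 * (cos \<rho> * inverse (sin \<rho>)) * sin \<psi> - 3" for \<rho> \<phi> \<psi>
    by (simp add: turning_def cot_def divide_inverse)
  show "lip_close {a..b} \<delta> (\<lambda>s. turning (r1 s) (\<theta>1 s) (\<alpha>1 s)) (\<lambda>s. turning (r2 s) (\<theta>2 s) (\<alpha>2 s))"
    unfolding eq
    by (rule r \<theta> \<alpha> ri \<theta>i lip_close_const[OF nn] | rule lip_close_diff lip_close_mult)+
qed

text \<open>
  The squared distance \<open>d\<close> of two solutions satisfies \<open>|d'| \<le> C d\<close>; the factor \<open>3\<close> in the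
  constant compares \<open>(p + q + w)\<^sup>2\<close> with \<open>p\<^sup>2 + q\<^sup>2 + w\<^sup>2\<close>.
\<close>

lemma profile_flow_unique_Icc:
  assumes f1: "profile_flow {a..b} r1 \<theta>1 \<alpha>1" and f2: "profile_flow {a..b} r2 \<theta>2 \<alpha>2"
    and c: "c = a \<or> c = b" "r1 c = r2 c" "\<theta>1 c = \<theta>2 c" "\<alpha>1 c = \<alpha>2 c" and x: "x \<in> {a..b}"
  shows "r1 x = r2 x \<and> \<theta>1 x = \<theta>2 x \<and> \<alpha>1 x = \<alpha>2 x"
proof -
  define \<delta> where "\<delta> x = \<bar>r1 x - r2 x\<bar> + \<bar>\<theta>1 x - \<theta>2 x\<bar> + \<bar>\<alpha>1 x - \<alpha>2 x\<bar>" for x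
  obtain K1 where K1: "\<And>x. x \<in> {a..b} \<Longrightarrow> \<bar>cos (\<alpha>1 x) - cos (\<alpha>2 x)\<bar> \<le> K1 * \<delta> x"
    using profile_flow_lip_close(1)[OF f1 f2] unfolding lip_close_def \<delta>_def by blast
  obtain K2 where K2: "\<And>x. x \<in> {a..b} \<Longrightarrow> \<bar>sin (\<alpha>1 x) / sin (r1 x) - sin (\<alpha>2 x) / sin (r2 x)\<bar> \<le> K2 * \<delta> x"
    using profile_flow_lip_close(2)[OF f1 f2] unfolding lip_close_def \<delta>_def by blast
  obtain K3 where K3: "\<And>x. x \<in> {a..b} \<Longrightarrow>
      \<bar>turning (r1 x) (\<theta>1 x) (\<alpha>1 x) - turning (r2 x) (\<theta>2 x) (\<alpha>2 x)\<bar> \<le> K3 * \<delta> x"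
    using profile_flow_lip_close(3)[OF f1 f2] unfolding lip_close_def \<delta>_def by blast
  define K where "K = \<bar>K1\<bar> + \<bar>K2\<bar> + \<bar>K3\<bar>"
  have nn: "\<delta> x \<ge> 0" for x by (simp add: \<delta>_def)
  have K: "k * \<delta> x \<le> K * \<delta> x" if "k = K1 \<or> k = K2 \<or> k = K3" for k x
    using that by (intro mult_right_mono nn) (auto simp: K_def)
  define d where "d x = (r1 x - r2 x)\<^sup>2 + (\<theta>1 x - \<theta>2 x)\<^sup>2 + (\<alpha>1 x - \<alpha>2 x)\<^sup>2" for x
  define d' where "d' x = 2 * ((r1 x - r2 x) * (cos (\<alpha>1 x) - cos (\<alpha>2 x))
     + (\<theta>1 x - \<theta>2 x) * (sin (\<alpha>1 x) / sin (r1 x) - sin (\<alpha>2 x) / sin (r2 x))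
     + (\<alpha>1 x - \<alpha>2 x) * (turning (r1 x) (\<theta>1 x) (\<alpha>1 x) - turning (r2 x) (\<theta>2 x) (\<alpha>2 x)))" for x
  have "d x = 0"
  proof (rule zero_of_abs_deriv_le[where d = d and d' = d' and a = a and b = b and C = "6 * K", OF _ _ _ c(1) _ x])
    fix x assume x: "x \<in> {a..b}"
    have D: "(r1 has_real_derivative cos (\<alpha>1 x)) (at x within {a..b})" "(r2 has_real_derivative cos (\<alpha>2 x)) (at x within {a..b})"
      "(\<theta>1 has_real_derivative sin (\<alpha>1 x) / sin (r1 x)) (at x within {a..b})" "(\<theta>2 has_real_derivative sin (\<alpha>2 x) / sin (r2 x)) (at x within {a..b})"
      "(\<alpha>1 has_real_derivative turning (r1 x) (\<theta>1 x) (\<alpha>1 x)) (at x within {a..b})" "(\<alpha>2 has_real_derivative turning (r2 x) (\<theta>2 x) (\<alpha>2 x)) (at x within {a..b})"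
      using profile_flowD[OF f1 x] profile_flowD[OF f2 x] by simp_all
    show "(d has_real_derivative d' x) (at x within {a..b})"
      unfolding d_def[abs_def] d'_def by (rule derivative_eq_intros D refl | simp)+
    have "\<bar>d' x\<bar> \<le> 2 * (\<bar>r1 x - r2 x\<bar> * (K * \<delta> x) + \<bar>\<theta>1 x - \<theta>2 x\<bar> * (K * \<delta> x) + \<bar>\<alpha>1 x - \<alpha>2 x\<bar> * (K * \<delta> x))"
    proof -
      have m: "\<bar>u * v\<bar> \<le> \<bar>u\<bar> * (K * \<delta> x)" if "\<bar>v\<bar> \<le> k * \<delta> x" "k = K1 \<or> k = K2 \<or> k = K3" for u v k
        using order_trans[OF that(1) K[OF that(2), of x]] by (simp add: abs_mult mult_left_mono)
      have abs3: "\<bar>2 * (p + q + w)\<bar> \<le> 2 * (P + Q + W)" if "\<bar>p\<bar> \<le> P" "\<bar>q\<bar> \<le> Q" "\<bar>w\<bar> \<le> W" for p q w P Q W :: real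
        using that by (auto simp: abs_le_iff)
      show ?thesis
        unfolding d'_def by (intro abs3 m[OF K1[OF x]] m[OF K2[OF x]] m[OF K3[OF x]]) auto
    qed
    also have "\<dots> = 2 * K * (\<delta> x)\<^sup>2" by (simp add: \<delta>_def power2_eq_square algebra_simps)
    also have "\<dots> \<le> 2 * K * (3 * d x)"
    proof (intro mult_left_mono)
      have "(p + q + w)\<^sup>2 \<le> 3 * (p\<^sup>2 + q\<^sup>2 + w\<^sup>2)" for p q w :: real
      proof -
        have "0 \<le> (p - q)\<^sup>2 + (q - w)\<^sup>2 + (p - w)\<^sup>2" by simp
        then show ?thesis by (simp add: power2_eq_square algebra_simps)
      qed
      from this[of "\<bar>r1 x - r2 x\<bar>" "\<bar>\<theta>1 x - \<theta>2 x\<bar>" "\<bar>\<alpha>1 x - \<alpha>2 x\<bar>"]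
      show "(\<delta> x)\<^sup>2 \<le> 3 * d x" by (simp add: \<delta>_def d_def)
    qed (simp add: K_def)
    finally show "\<bar>d' x\<bar> \<le> 6 * K * d x" by simp
  qed (auto simp: d_def c)
  then show ?thesis by (simp add: d_def add_nonneg_eq_0_iff)
qed

lemma profile_flow_unique:
  assumes J: "is_interval J" and f1: "profile_flow J r1 \<theta>1 \<alpha>1" and f2: "profile_flow J r2 \<theta>2 \<alpha>2"
    and c: "c \<in> J" "r1 c = r2 c" "\<theta>1 c = \<theta>2 c" "\<alpha>1 c = \<alpha>2 c" and x: "x \<in> J"
  shows "r1 x = r2 x \<and> \<theta>1 x = \<theta>2 x \<and> \<alpha>1 x = \<alpha>2 x"
proof -
  have sub: "{min c x..max c x} \<subseteq> J"
    using mem_is_interval_1_I[OF J c(1) x] mem_is_interval_1_I[OF J x c(1)]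
    by (auto simp: min_def max_def split: if_splits)
  show ?thesis
    by (rule profile_flow_unique_Icc[OF profile_flow_subset[OF f1 sub] profile_flow_subset[OF f2 sub], of c])
       (use c in auto)
qed

text \<open>
  Beyond a common point in the direction of \<open>s\<close>, the interval \<open>J2\<close> stops before \<open>s\<close>, hence is contained
  in \<open>J1\<close>; so the union looks like \<open>J1\<close> near \<open>s\<close>.
\<close>

lemma DERIV_union_one_side:
  fixes f :: "real \<Rightarrow> real"
  assumes J: "is_interval J1" "is_interval J2" and c: "c \<in> J1" "c \<in> J2" and s: "s \<in> J1" "s \<notin> J2"
    and D: "(f has_real_derivative D) (at s within J1)"
  shows "(f has_real_derivative D) (at s within (J1 \<union> J2))"
proof -
  have "s \<noteq> c" using c s by blast
  then consider "c < s" | "s < c" by linarith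
  then have "at s within (J1 \<union> J2) = at s within J1"
  proof cases
    case 1
    have "x \<in> J1" if "x \<in> J2" "c < x" for x
    proof -
      have "x < s" using mem_is_interval_1_I[OF J(2) c(2) that(1), of s] 1 s(2) by force
      then show ?thesis using mem_is_interval_1_I[OF J(1) c(1) s(1), of x] that by simp
    qed
    then show ?thesis by (intro at_within_nhd[of _ "{c<..}"]) (use 1 in auto)
  next
    case 2
    have "x \<in> J1" if "x \<in> J2" "x < c" for x
    proof -
      have "s < x" using mem_is_interval_1_I[OF J(2) that(1) c(2), of s] 2 s(2) by force
      then show ?thesis using mem_is_interval_1_I[OF J(1) s(1) c(1), of x] that by simp
    qed
    then show ?thesis by (intro at_within_nhd[of _ "{..<c}"]) (use 2 in auto)
  qed
  then show ?thesis using D by simp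
qed

lemma DERIV_glue:
  fixes f :: "real \<Rightarrow> real"
  assumes J: "is_interval J1" "is_interval J2" and c: "c \<in> J1" "c \<in> J2" and s: "s \<in> J1 \<union> J2"
    and f1: "\<And>x. x \<in> J1 \<Longrightarrow> f x = f1 x" and f2: "\<And>x. x \<in> J2 \<Longrightarrow> f x = f2 x"
    and D1: "s \<in> J1 \<Longrightarrow> (f1 has_real_derivative D) (at s within J1)"
    and D2: "s \<in> J2 \<Longrightarrow> (f2 has_real_derivative D) (at s within J2)"
  shows "(f has_real_derivative D) (at s within (J1 \<union> J2))"
proof -
  have E1: "(f has_real_derivative D) (at s within J1)" if "s \<in> J1"
    using has_field_derivative_transform_within[OF D1[OF that] zero_less_one that] f1 by simp
  have E2: "(f has_real_derivative D) (at s within J2)" if "s \<in> J2"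
    using has_field_derivative_transform_within[OF D2[OF that] zero_less_one that] f2 by simp
  show ?thesis
  proof (cases "s \<in> J1 \<and> s \<in> J2")
    case True
    then show ?thesis
      using E1 E2 unfolding has_field_derivative_iff by (simp add: at_within_union filterlim_sup)
  next
    case False
    then show ?thesis
      using s E1 E2 DERIV_union_one_side[OF J c, of s f D] DERIV_union_one_side[OF J(2,1) c(2,1), of s f D]
      by (auto simp: Un_commute)
  qed
qed

lemma profile_flow_glue:
  assumes J: "is_interval J1" "is_interval J2" and c: "c \<in> J1" "c \<in> J2"
    and f1: "profile_flow J1 r1 \<theta>1 \<alpha>1" and f2: "profile_flow J2 r2 \<theta>2 \<alpha>2"
    and eq: "\<And>x. x \<in> J1 \<Longrightarrow> x \<in> J2 \<Longrightarrow> r1 x = r2 x \<and> \<theta>1 x = \<theta>2 x \<and> \<alpha>1 x = \<alpha>2 x"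
  shows "profile_flow (J1 \<union> J2) (\<lambda>x. if x \<in> J1 then r1 x else r2 x)
     (\<lambda>x. if x \<in> J1 then \<theta>1 x else \<theta>2 x) (\<lambda>x. if x \<in> J1 then \<alpha>1 x else \<alpha>2 x)"
    (is "profile_flow _ ?r ?\<theta> ?\<alpha>")
  unfolding profile_flow_def
proof
  fix s assume s: "s \<in> J1 \<union> J2"
  have e1: "?r x = r1 x" "?\<theta> x = \<theta>1 x" "?\<alpha> x = \<alpha>1 x" if "x \<in> J1" for x using that by simp_all
  have e2: "?r x = r2 x" "?\<theta> x = \<theta>2 x" "?\<alpha> x = \<alpha>2 x" if "x \<in> J2" for x using that eq by simp_all
  have 1: "sin (?r s) \<noteq> 0" "sin (2 * ?\<theta> s) \<noteq> 0"
    using s profile_flowD(1,2)[OF f1, of s] profile_flowD(1,2)[OF f2, of s] by auto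
  have "(?r has_real_derivative cos (?\<alpha> s)) (at s within J1 \<union> J2)"
    by (rule DERIV_glue[OF J c s e1(1) e2(1)])
       (use profile_flowD[OF f1, of s] profile_flowD[OF f2, of s] e1[of s] e2[of s] in simp_all)
  moreover have "(?\<theta> has_real_derivative sin (?\<alpha> s) / sin (?r s)) (at s within J1 \<union> J2)"
    by (rule DERIV_glue[OF J c s e1(2) e2(2)])
       (use profile_flowD[OF f1, of s] profile_flowD[OF f2, of s] e1[of s] e2[of s] in simp_all)
  moreover have "(?\<alpha> has_real_derivative turning (?r s) (?\<theta> s) (?\<alpha> s)) (at s within J1 \<union> J2)"
    by (rule DERIV_glue[OF J c s e1(3) e2(3)])
       (use profile_flowD[OF f1, of s] profile_flowD[OF f2, of s] e1[of s] e2[of s] in simp_all)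
  ultimately show "sin (?r s) \<noteq> 0 \<and> sin (2 * ?\<theta> s) \<noteq> 0 \<and>
        (?r has_real_derivative cos (?\<alpha> s)) (at s within J1 \<union> J2) \<and>
        (?\<theta> has_real_derivative sin (?\<alpha> s) / sin (?r s)) (at s within J1 \<union> J2) \<and>
        (?\<alpha> has_real_derivative turning (?r s) (?\<theta> s) (?\<alpha> s)) (at s within J1 \<union> J2)"
    using 1 by blast
qed

section \<open>Symmetries of maximal solutions\<close>

lemma DERIV_reflect:
  fixes f :: "real \<Rightarrow> real"
  assumes "(f has_real_derivative D) (at (k - s) within J)"
  shows "((\<lambda>s. f (k - s)) has_real_derivative - D) (at s within (\<lambda>s. k - s) ` J)"
proof -
  have "((\<lambda>s. f (k - s)) has_derivative (\<lambda>h. D * (- h))) (at s within (\<lambda>s. k - s) ` J)"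
    by (rule has_derivative_in_compose[where g = f and g' = "(*) D"])
       (use assms in \<open>auto intro!: derivative_eq_intros simp: image_image has_field_derivative_def\<close>)
  then show ?thesis
    unfolding has_field_derivative_def by (rule has_derivative_eq_rhs) (simp add: fun_eq_iff)
qed

text \<open>
  The reflection of the sphere in its equator, combined with a reversal of time.
\<close>

lemma profile_flow_reflect_axis:
  assumes "profile_flow J r \<theta> \<alpha>"
  shows "profile_flow ((\<lambda>s. k - s) ` J) (\<lambda>s. pi - r (k - s)) (\<lambda>s. \<theta> (k - s)) (\<lambda>s. 2 * pi - \<alpha> (k - s))"
  unfolding profile_flow_def
proof
  fix s assume "s \<in> (\<lambda>s. k - s) ` J"
  then have "k - s \<in> J" by auto
  then have n: "sin (r (k - s)) \<noteq> 0" "sin (2 * \<theta> (k - s)) \<noteq> 0"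
    and D: "(r has_real_derivative cos (\<alpha> (k - s))) (at (k - s) within J)"
    "(\<theta> has_real_derivative sin (\<alpha> (k - s)) / sin (r (k - s))) (at (k - s) within J)"
    "(\<alpha> has_real_derivative turning (r (k - s)) (\<theta> (k - s)) (\<alpha> (k - s))) (at (k - s) within J)"
    using profile_flowD[OF assms \<open>k - s \<in> J\<close>] by simp_all
  have *: "sin (2 * pi - x) = - sin x" "cos (2 * pi - x) = cos x" "sin (pi - x) = sin x" "cos (pi - x) = - cos x" for x :: real
    by (simp_all add: sin_diff cos_diff)
  show "sin (pi - r (k - s)) \<noteq> 0 \<and> sin (2 * \<theta> (k - s)) \<noteq> 0 \<and>
    ((\<lambda>s. pi - r (k - s)) has_real_derivative cos (2 * pi - \<alpha> (k - s))) (at s within (\<lambda>s. k - s) ` J) \<and>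
    ((\<lambda>s. \<theta> (k - s)) has_real_derivative sin (2 * pi - \<alpha> (k - s)) / sin (pi - r (k - s))) (at s within (\<lambda>s. k - s) ` J) \<and>
    ((\<lambda>s. 2 * pi - \<alpha> (k - s)) has_real_derivative turning (pi - r (k - s)) (\<theta> (k - s)) (2 * pi - \<alpha> (k - s)))
     (at s within (\<lambda>s. k - s) ` J)"
    using n DERIV_reflect[OF D(1)] DERIV_reflect[OF D(2)] DERIV_reflect[OF D(3)]
      DERIV_diff[OF DERIV_const[of pi] DERIV_reflect[OF D(1)]] DERIV_diff[OF DERIV_const[of "2 * pi"] DERIV_reflect[OF D(3)]]
    by (simp add: * turning_def cot_def)
qed

text \<open>
  The reflection that exchanges \<open>X\<close> and \<open>Y\<close>, combined with a reversal of time.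
\<close>

lemma profile_flow_reflect_diagonal:
  assumes "profile_flow J r \<theta> \<alpha>"
  shows "profile_flow ((\<lambda>s. k - s) ` J) (\<lambda>s. r (k - s)) (\<lambda>s. pi / 2 - \<theta> (k - s)) (\<lambda>s. pi - \<alpha> (k - s))"
  unfolding profile_flow_def
proof
  fix s assume "s \<in> (\<lambda>s. k - s) ` J"
  then have "k - s \<in> J" by auto
  then have n: "sin (r (k - s)) \<noteq> 0" "sin (2 * \<theta> (k - s)) \<noteq> 0"
    and D: "(r has_real_derivative cos (\<alpha> (k - s))) (at (k - s) within J)"
    "(\<theta> has_real_derivative sin (\<alpha> (k - s)) / sin (r (k - s))) (at (k - s) within J)"
    "(\<alpha> has_real_derivative turning (r (k - s)) (\<theta> (k - s)) (\<alpha> (k - s))) (at (k - s) within J)"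
    using profile_flowD[OF assms \<open>k - s \<in> J\<close>] by simp_all
  have *: "2 * (pi / 2 - x) = pi - 2 * x" "sin (pi - x) = sin x" "cos (pi - x) = - cos x" for x :: real
    by (simp_all add: sin_diff cos_diff)
  show "sin (r (k - s)) \<noteq> 0 \<and> sin (2 * (pi / 2 - \<theta> (k - s))) \<noteq> 0 \<and>
    ((\<lambda>s. r (k - s)) has_real_derivative cos (pi - \<alpha> (k - s))) (at s within (\<lambda>s. k - s) ` J) \<and>
    ((\<lambda>s. pi / 2 - \<theta> (k - s)) has_real_derivative sin (pi - \<alpha> (k - s)) / sin (r (k - s))) (at s within (\<lambda>s. k - s) ` J) \<and>
    ((\<lambda>s. pi - \<alpha> (k - s)) has_real_derivative turning (r (k - s)) (pi / 2 - \<theta> (k - s)) (pi - \<alpha> (k - s)))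
     (at s within (\<lambda>s. k - s) ` J)"
    using n DERIV_reflect[OF D(1)]
      DERIV_diff[OF DERIV_const[of "pi / 2"] DERIV_reflect[OF D(2)]] DERIV_diff[OF DERIV_const[of pi] DERIV_reflect[OF D(3)]]
    by (simp add: * turning_def cot_def)
qed

text \<open>
  By uniqueness the two solutions agree on the intersection of their domains, so they can be glued to
  a solution on the union, which maximality identifies with \<open>J\<close>.
\<close>

lemma maximal_profile_solution_absorbs:
  assumes max: "maximal_profile_solution a J r \<theta> \<alpha>"
    and J': "is_interval J'" "profile_flow J' r' \<theta>' \<alpha>'"
    and c: "c \<in> J" "c \<in> J'" "r c = r' c" "\<theta> c = \<theta>' c" "\<alpha> c = \<alpha>' c"
  shows "J' \<subseteq> J"
proof -
  have sol: "is_interval J" "0 \<in> J" "r 0 = pi / 2" "\<theta> 0 = a" "\<alpha> 0 = pi" "profile_flow J r \<theta> \<alpha>"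
    using max unfolding maximal_profile_solution_def profile_solution_iff by blast+
  have "is_interval (J \<inter> J')" using sol(1) J'(1) by (rule is_interval_Int)
  then have eq: "r x = r' x \<and> \<theta> x = \<theta>' x \<and> \<alpha> x = \<alpha>' x" if "x \<in> J" "x \<in> J'" for x
    by (rule profile_flow_unique[OF _ profile_flow_subset[OF sol(6)] profile_flow_subset[OF J'(2)], of "J \<inter> J'" c])
       (use c that in auto)
  have "is_interval (J \<union> J')"
    using sol(1) J'(1) c(1,2) by (metis connected_Un disjoint_iff is_interval_connected_1)
  then have P: "profile_solution a (J \<union> J') (\<lambda>x. if x \<in> J then r x else r' x)
     (\<lambda>x. if x \<in> J then \<theta> x else \<theta>' x) (\<lambda>x. if x \<in> J then \<alpha> x else \<alpha>' x)"
    unfolding profile_solution_iff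
    using profile_flow_glue[OF sol(1) J'(1) c(1,2) sol(6) J'(2) eq] sol by simp
  have "J \<union> J' = J"
    by (rule max[unfolded maximal_profile_solution_def, THEN conjunct2, rule_format], intro conjI, rule P) auto
  then show ?thesis by blast
qed

lemma reflected_interval: "is_interval J \<Longrightarrow> is_interval ((\<lambda>s. k - s) ` J :: real set)"
  unfolding is_interval_connected_1 by (intro connected_continuous_image continuous_intros)

text \<open>
  The two reflections generate the translation by \<open>2 t\<close>.
\<close>

lemma interval_closed_under_reflections:
  fixes J :: "real set"
  assumes J: "is_interval J" "0 \<in> J" and t: "t > 0"
    and r0: "\<And>s. s \<in> J \<Longrightarrow> - s \<in> J" and rt: "\<And>s. s \<in> J \<Longrightarrow> 2 * t - s \<in> J"
  shows "J = UNIV"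
proof -
  have n: "real n * (2 * t) \<in> J" for n
  proof (induction n)
    case (Suc n)
    have "2 * t - (- (real n * (2 * t))) \<in> J" by (intro rt r0 Suc)
    then show ?case by (simp add: algebra_simps)
  qed (simp add: J)
  have "x \<in> J" for x
  proof -
    obtain n where "\<bar>x\<bar> < real n * (2 * t)" using reals_Archimedean3[of "2 * t"] t by auto
    then have "- (real n * (2 * t)) \<le> x" "x \<le> real n * (2 * t)" by auto
    then show ?thesis by (rule mem_is_interval_1_I[OF J(1) r0[OF n[of n]] n[of n]])
  qed
  then show ?thesis by blast
qed

text \<open>
  Both reflections fix the solution at one time: the first at \<open>0\<close>, where \<open>r = pi / 2\<close> and
  \<open>\<alpha> = pi\<close>, the second at \<open>t\<close>, where \<open>\<theta> = pi / 4\<close> and \<open>\<alpha> = pi / 2\<close>.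
\<close>

lemma maximal_profile_solution_symmetric:
  assumes max: "maximal_profile_solution a J r \<theta> \<alpha>" and t: "t > 0" "t \<in> J" "\<alpha> t = pi / 2" "\<theta> t = pi / 4"
  shows "J = UNIV" "profile_flow UNIV r \<theta> \<alpha>"
    "\<And>s. r (- s) = pi - r s" "\<And>s. \<theta> (- s) = \<theta> s" "\<And>s. \<alpha> (- s) = 2 * pi - \<alpha> s"
    "\<And>s. r (2 * t - s) = r s" "\<And>s. \<theta> (2 * t - s) = pi / 2 - \<theta> s" "\<And>s. \<alpha> (2 * t - s) = pi - \<alpha> s"
proof -
  have sol: "is_interval J" "0 \<in> J" "r 0 = pi / 2" "\<theta> 0 = a" "\<alpha> 0 = pi" and flow: "profile_flow J r \<theta> \<alpha>"
    using max unfolding maximal_profile_solution_def profile_solution_iff by blast+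
  note A = profile_flow_reflect_axis[OF flow, of 0] and B = profile_flow_reflect_diagonal[OF flow, of "2 * t"]
  have r0: "(\<lambda>s. 0 - s) ` J \<subseteq> J"
    by (rule maximal_profile_solution_absorbs[OF max reflected_interval[OF sol(1)] A, of 0])
       (use sol in auto)
  have t2: "t \<in> (\<lambda>s. 2 * t - s) ` J" by (rule image_eqI[of _ _ t]) (use t in auto)
  have rt: "(\<lambda>s. 2 * t - s) ` J \<subseteq> J"
    by (rule maximal_profile_solution_absorbs[OF max reflected_interval[OF sol(1)] B t(2) t2])
       (use t in auto)
  show J: "J = UNIV"
    by (rule interval_closed_under_reflections[OF sol(1,2) t(1)]) (use r0 rt in auto)
  show f: "profile_flow UNIV r \<theta> \<alpha>" using flow J by simp
  have surj: "(\<lambda>s. k - s) ` (UNIV :: real set) = UNIV" for k by (rule surjI[of _ "\<lambda>s. k - s"]) simp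
  have U: "r s = pi - r (0 - s) \<and> \<theta> s = \<theta> (0 - s) \<and> \<alpha> s = 2 * pi - \<alpha> (0 - s)" for s
    by (rule profile_flow_unique[OF is_interval_univ f A[unfolded J surj], of 0]) (use sol in auto)
  show "r (- s) = pi - r s" "\<theta> (- s) = \<theta> s" "\<alpha> (- s) = 2 * pi - \<alpha> s" for s
    using U[of s] by simp_all
  have V: "r s = r (2 * t - s) \<and> \<theta> s = pi / 2 - \<theta> (2 * t - s) \<and> \<alpha> s = pi - \<alpha> (2 * t - s)" for s
    by (rule profile_flow_unique[OF is_interval_univ f B[unfolded J surj], of t]) (use t in auto)
  show "r (2 * t - s) = r s" "\<theta> (2 * t - s) = pi / 2 - \<theta> s" "\<alpha> (2 * t - s) = pi - \<alpha> s" for s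
    using V[of s] by simp_all
qed

section \<open>Regularity and shape of the profile curve\<close>

lemma profile_flow_UNIV_D:
  assumes "profile_flow UNIV r \<theta> \<alpha>"
  shows "(r has_real_derivative cos (\<alpha> s)) (at s)" "(\<theta> has_real_derivative sin (\<alpha> s) / sin (r s)) (at s)"
    "(\<alpha> has_real_derivative turning (r s) (\<theta> s) (\<alpha> s)) (at s)"
  using profile_flowD(3-5)[OF assms UNIV_I] by simp_all

text \<open>
  The right-hand sides are smooth functions of the unknowns, so each degree of regularity of the
  solution yields the next.
\<close>

lemma profile_flow_smooth:
  assumes flow: "profile_flow UNIV r \<theta> \<alpha>"
  shows "smooth_on UNIV r" "smooth_on UNIV \<theta>" "smooth_on UNIV \<alpha>"
proof -
  note D = profile_flow_UNIV_D[OF flow] and nz = profile_flowD(1,2)[OF flow UNIV_I]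
  have Ck: "Ck_on k r UNIV \<and> Ck_on k \<theta> UNIV \<and> Ck_on k \<alpha> UNIV" for k
  proof (induction k)
    case 0
    show ?case using D by (auto intro!: continuous_at_imp_continuous_on DERIV_isCont)
  next
    case (Suc k)
    then have k: "Ck_on k r UNIV" "Ck_on k \<theta> UNIV" "Ck_on k \<alpha> UNIV" by blast+
    have sc: "Ck_on k (\<lambda>s. sin (f s)) UNIV" "Ck_on k (\<lambda>s. cos (f s)) UNIV" if "Ck_on k f UNIV" for f :: "real \<Rightarrow> real"
      by (rule Ck_on_compose[OF open_UNIV subset_UNIV that], simp add: Ck_on_sin_cos)+
    have 2: "Ck_on k (\<lambda>s. 2 * \<theta> s) UNIV" by (rule Ck_on_mult[OF open_UNIV Ck_on_const k(2)])
    have i: "Ck_on k (\<lambda>s. inverse (sin (r s))) UNIV" "Ck_on k (\<lambda>s. inverse (sin (2 * \<theta> s))) UNIV"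
      by (rule Ck_on_inverse[OF open_UNIV sc(1)[OF k(1)] nz(1)], rule Ck_on_inverse[OF open_UNIV sc(1)[OF 2] nz(2)])
    have eq: "turning \<rho> \<phi> \<psi> = 2 * (cos (2 * \<phi>) * inverse (sin (2 * \<phi>))) * inverse (sin \<rho>) * cos \<psi>
       + (- 3 * (cos \<rho> * inverse (sin \<rho>)) * sin \<psi> + (- 3))" for \<rho> \<phi> \<psi>
      by (simp add: turning_def cot_def divide_inverse)
    have "Ck_on k (\<lambda>s. sin (\<alpha> s) / sin (r s)) UNIV"
      unfolding divide_inverse by (rule Ck_on_mult[OF open_UNIV sc(1)[OF k(3)] i(1)])
    moreover have "Ck_on k (\<lambda>s. turning (r s) (\<theta> s) (\<alpha> s)) UNIV"
      unfolding eq by (intro Ck_on_add Ck_on_mult Ck_on_const open_UNIV sc 2 i k)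
    ultimately show ?case
      using Ck_on_SucI_real[OF open_UNIV D(1) sc(2)[OF k(3)]] Ck_on_SucI_real[OF open_UNIV D(2)]
        Ck_on_SucI_real[OF open_UNIV D(3)] by blast
  qed
  then show "smooth_on UNIV r" "smooth_on UNIV \<theta>" "smooth_on UNIV \<alpha>" by (auto simp: smooth_on_def)
qed

lemma sin_cos_near_half_pi:
  fixes x m :: real
  assumes "\<bar>pi / 2 - x\<bar> \<le> m"
  shows "sin x \<ge> 1 - m\<^sup>2 / 2" "\<bar>cos x\<bar> \<le> m"
proof -
  define y where "y = pi / 2 - x"
  have s: "sin x = cos y" "cos x = sin y" unfolding y_def by (simp_all add: sin_diff cos_diff)
  have "cos y = 1 - 2 * (sin (y / 2))\<^sup>2" using cos_double_sin[of "y / 2"] by simp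
  moreover have "(sin (y / 2))\<^sup>2 \<le> (m / 2)\<^sup>2"
  proof -
    have "\<bar>sin (y / 2)\<bar> \<le> \<bar>y / 2\<bar>" by (rule abs_sin_x_le_abs_x)
    also have "\<dots> \<le> m / 2" using assms by (simp add: y_def)
    finally show ?thesis using abs_le_square_iff[of "sin (y / 2)" "m / 2"] by simp
  qed
  ultimately show "sin x \<ge> 1 - m\<^sup>2 / 2" by (simp add: s power_divide)
  show "\<bar>cos x\<bar> \<le> m" using abs_sin_x_le_abs_x[of y] assms by (simp add: s y_def)
qed

text \<open>
  Here \<open>|cot \<rho>|\<close> is at most \<open>0.4 / 0.92\<close> and \<open>|cot (2 * \<phi>)|\<close> at most \<open>0.571 / 0.83\<close>, where
  \<open>0.571\<close> is an upper bound for \<open>pi / 2 - 1\<close>. It matters that the bound stays below \<open>3\<close>: the turning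
  speed is then negative for every \<open>\<psi>\<close>.
\<close>

lemma turning_bounds:
  assumes \<rho>: "\<bar>pi / 2 - \<rho>\<bar> \<le> 4 / 10" and \<phi>: "5 / 10 \<le> \<phi>" "\<phi> \<le> 96 / 100"
  shows "\<bar>turning \<rho> \<phi> \<psi> + 3\<bar> \<le> 29 / 10"
proof -
  have pi: "314 / 100 \<le> pi" "pi \<le> 3142 / 1000" using pi_approx by simp_all
  have r: "sin \<rho> \<ge> 92 / 100" "\<bar>cos \<rho>\<bar> \<le> 4 / 10"
    using sin_cos_near_half_pi[OF \<rho>] by (simp_all add: power2_eq_square)
  have "\<bar>pi / 2 - 2 * \<phi>\<bar> \<le> 571 / 1000" unfolding abs_le_iff using \<phi> pi by auto
  from sin_cos_near_half_pi[OF this] have p: "sin (2 * \<phi>) \<ge> 83 / 100" "\<bar>cos (2 * \<phi>)\<bar> \<le> 571 / 1000"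
    by (simp_all add: power2_eq_square)
  have "\<bar>cos \<rho>\<bar> / sin \<rho> \<le> (4 / 10) / (92 / 100)" by (intro frac_le r) simp_all
  moreover have "\<bar>cos (2 * \<phi>)\<bar> / sin (2 * \<phi>) \<le> (571 / 1000) / (83 / 100)" by (intro frac_le p) simp_all
  ultimately have c: "\<bar>cot \<rho>\<bar> \<le> 44 / 100" "\<bar>cot (2 * \<phi>)\<bar> \<le> 69 / 100"
    using r p by (simp_all add: cot_def)
  have "\<bar>cot (2 * \<phi>) / sin \<rho> * cos \<psi>\<bar> = \<bar>cot (2 * \<phi>)\<bar> / sin \<rho> * \<bar>cos \<psi>\<bar>"
    using r(1) by (simp add: abs_mult)
  also have "\<dots> \<le> (69 / 100) / (92 / 100) * 1"
    using r(1) by (intro mult_mono frac_le c) auto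
  finally have 1: "\<bar>cot (2 * \<phi>) / sin \<rho> * cos \<psi>\<bar> \<le> 75 / 100" by simp
  have "\<bar>cot \<rho>\<bar> * \<bar>sin \<psi>\<bar> \<le> (44 / 100) * 1" by (intro mult_mono c) auto
  then have 2: "\<bar>cot \<rho> * sin \<psi>\<bar> \<le> 44 / 100" by (simp add: abs_mult)
  have "turning \<rho> \<phi> \<psi> + 3 = 2 * (cot (2 * \<phi>) / sin \<rho> * cos \<psi>) - 3 * (cot \<rho> * sin \<psi>)"
    by (simp add: turning_def)
  moreover have "\<bar>2 * x - 3 * y\<bar> \<le> 29 / 10" if "\<bar>x\<bar> \<le> 75 / 100" "\<bar>y\<bar> \<le> 44 / 100" for x y :: real
    using that by linarith
  ultimately show ?thesis using 1 2 by presburger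
qed

context
  fixes a T :: real and r \<theta> \<alpha> :: "real \<Rightarrow> real"
  assumes flow: "profile_flow UNIV r \<theta> \<alpha>"
    and init: "r 0 = pi / 2" "\<theta> 0 = a" "\<alpha> 0 = pi"
    and a: "52 / 100 < a" "a < 525 / 1000"
    and T: "T \<le> 4 / 10"
begin

lemma r_near_equator:
  assumes "0 \<le> s" shows "\<bar>pi / 2 - r s\<bar> \<le> s"
proof (cases "s = 0")
  case False
  then obtain z where "r s - r 0 = (s - 0) * cos (\<alpha> z)"
    using MVT2[of 0 s r "\<lambda>z. cos (\<alpha> z)"] profile_flow_UNIV_D(1)[OF flow] assms by auto
  then have "\<bar>r s - pi / 2\<bar> = \<bar>s\<bar> * \<bar>cos (\<alpha> z)\<bar>" by (simp add: init abs_mult)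
  also have "\<dots> \<le> \<bar>s\<bar> * 1" by (intro mult_left_mono) auto
  finally show ?thesis using assms by (simp add: abs_minus_commute)
qed (simp add: init)

lemma turning_along:
  assumes "0 \<le> s" "s \<le> T" "5 / 10 < \<theta> s" "\<theta> s < 96 / 100"
  shows "- 59 / 10 \<le> turning (r s) (\<theta> s) (\<alpha> s)" "turning (r s) (\<theta> s) (\<alpha> s) \<le> - 1 / 10"
proof -
  have "\<bar>pi / 2 - r s\<bar> \<le> 4 / 10" using r_near_equator[OF assms(1)] assms(2) T by simp
  then have "\<bar>turning (r s) (\<theta> s) (\<alpha> s) + 3\<bar> \<le> 29 / 10" by (rule turning_bounds) (use assms in auto)
  then show "- 59 / 10 \<le> turning (r s) (\<theta> s) (\<alpha> s)" "turning (r s) (\<theta> s) (\<alpha> s) \<le> - 1 / 10"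
    unfolding abs_le_iff by auto
qed

text \<open>
  The angle decreases at a speed of at most \<open>5.9\<close>, and \<open>0.4 * 5.9 = 2.36\<close> is less than \<open>pi\<close>.
\<close>

lemma \<alpha>_in_upper_half:
  assumes s: "0 < s" "s \<le> T" and \<theta>: "\<And>u. 0 < u \<Longrightarrow> u < s \<Longrightarrow> 5 / 10 < \<theta> u \<and> \<theta> u < 96 / 100"
  shows "0 < \<alpha> s" "\<alpha> s < pi"
proof -
  obtain z where z: "0 < z" "z < s" "\<alpha> s - \<alpha> 0 = (s - 0) * turning (r z) (\<theta> z) (\<alpha> z)"
    using MVT2[of 0 s \<alpha> "\<lambda>z. turning (r z) (\<theta> z) (\<alpha> z)"] profile_flow_UNIV_D(3)[OF flow] s by auto
  have t: "- 59 / 10 \<le> turning (r z) (\<theta> z) (\<alpha> z)" "turning (r z) (\<theta> z) (\<alpha> z) \<le> - 1 / 10"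
    using turning_along[of z] \<theta>[of z] z s by auto
  have "s * turning (r z) (\<theta> z) (\<alpha> z) < 0" using t(2) s by (intro mult_pos_neg) auto
  then show "\<alpha> s < pi" using z init by simp
  have "s * (59 / 10) \<le> (4 / 10) * (59 / 10)" using s T by (intro mult_right_mono) auto
  moreover have "s * (- 59 / 10) \<le> s * turning (r z) (\<theta> z) (\<alpha> z)" using t(1) s by (intro mult_left_mono) auto
  ultimately show "0 < \<alpha> s" using z init pi_gt3 by simp
qed

text \<open>
  Consider the first time \<open>w\<close> at which \<open>\<theta>\<close> leaves the range. Until then the angle is in the upper half
  plane, so \<open>\<theta>\<close> has not decreased, and it has grown by at most \<open>0.4 / 0.92 < 0.435\<close> from a value below
  \<open>0.525\<close>. So it cannot have left.
\<close>

lemma \<theta>_bounds: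
  assumes "0 \<le> s" "s \<le> T"
  shows "5 / 10 < \<theta> s \<and> \<theta> s < 96 / 100"
proof (rule ccontr)
  assume neg: "\<not> (5 / 10 < \<theta> s \<and> \<theta> s < 96 / 100)"
  have cont: "continuous_on {0..T} \<theta>"
    using profile_flow_UNIV_D(2)[OF flow] by (auto intro!: continuous_at_imp_continuous_on DERIV_isCont)
  define B where "B = {0..T} \<inter> \<theta> -` ({..5 / 10} \<union> {96 / 100..})"
  have "closed B" unfolding B_def by (intro continuous_closed_preimage cont closed_Un) auto
  moreover have "bounded B" by (rule bounded_subset[OF bounded_closed_interval]) (auto simp: B_def)
  ultimately have "compact B" by (simp add: compact_eq_bounded_closed)
  moreover have "s \<in> B" using assms neg by (auto simp: B_def)
  ultimately obtain w where w: "w \<in> B" "\<And>u. u \<in> B \<Longrightarrow> w \<le> u"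
    using compact_attains_inf[of B] by blast
  have w0: "0 < w" "w \<le> T" using w(1) a init by (auto simp: B_def less_le)
  have before: "5 / 10 < \<theta> u \<and> \<theta> u < 96 / 100" if "0 < u" "u < w" for u
    using w(2)[of u] that w0 by (force simp: B_def)
  obtain z where z: "0 < z" "z < w" "\<theta> w - \<theta> 0 = (w - 0) * (sin (\<alpha> z) / sin (r z))"
    using MVT2[of 0 w \<theta> "\<lambda>z. sin (\<alpha> z) / sin (r z)"] profile_flow_UNIV_D(2)[OF flow] w0 by auto
  have "0 < \<alpha> z" "\<alpha> z < pi" using \<alpha>_in_upper_half[of z] before z w0 by auto
  then have s0: "0 \<le> sin (\<alpha> z)" by (simp add: sin_gt_zero less_imp_le)
  have "\<bar>pi / 2 - r z\<bar> \<le> 4 / 10" using r_near_equator[of z] z w0 T by linarith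
  from sin_cos_near_half_pi(1)[OF this] have r: "sin (r z) \<ge> 92 / 100" by (simp add: power2_eq_square)
  have "sin (\<alpha> z) / sin (r z) \<le> 1 / (92 / 100)" using r by (intro frac_le) auto
  then have "w * (sin (\<alpha> z) / sin (r z)) \<le> (4 / 10) * (1 / (92 / 100))"
    using w0 T s0 r by (intro mult_mono) auto
  moreover have "0 \<le> w * (sin (\<alpha> z) / sin (r z))" using w0 s0 r by simp
  ultimately have "5 / 10 < \<theta> w" "\<theta> w < 96 / 100" using z(3) init a by auto
  then show False using w(1) by (auto simp: B_def)
qed

lemma \<alpha>_strict_decreasing:
  assumes "0 \<le> s" "s < s'" "s' \<le> T" shows "\<alpha> s' < \<alpha> s"
proof (rule DERIV_neg_imp_decreasing[OF assms(2)])
  fix x assume "s \<le> x" "x \<le> s'"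
  then show "\<exists>y. (\<alpha> has_real_derivative y) (at x) \<and> y < 0"
    using turning_along(2)[of x] \<theta>_bounds[of x] profile_flow_UNIV_D(3)[OF flow] assms
    by (intro exI[of _ "turning (r x) (\<theta> x) (\<alpha> x)"]) auto
qed

end

lemma in_open_interval_if_avoids_ends:
  fixes f :: "real \<Rightarrow> real"
  assumes "continuous_on UNIV f" "0 < f c" "f c < p" "\<And>x. f x \<noteq> 0" "\<And>x. f x \<noteq> p"
  shows "0 < f x" "f x < p"
proof -
  have I: "is_interval (range f)"
    unfolding is_interval_connected_1 using assms(1) connected_UNIV connected_continuous_image by blast
  have "0 \<notin> range f" "p \<notin> range f" using assms(4,5) by auto
  then show "0 < f x" "f x < p"
    using mem_is_interval_1_I[OF I, of "f x" "f c" 0] mem_is_interval_1_I[OF I, of "f c" "f x" p] assms(2,3)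
    by fastforce+
qed

text \<open>
  After a translation by periods both parameters lie in \<open>(- t, 3 t]\<close>. The coordinate \<open>\<theta>\<close> separates
  \<open>(- t, t)\<close> from \<open>[t, 3 t]\<close>, and on each of the two parts \<open>r\<close> is injective.
\<close>

lemma profile_curve_simple:
  fixes r \<theta> :: "real \<Rightarrow> real"
  assumes t: "t > 0"
    and refl: "\<And>s. r (2 * t - s) = r s" "\<And>s. \<theta> (2 * t - s) = pi / 2 - \<theta> s"
    and per: "\<And>s. r (s + 4 * t) = r s" "\<And>s. \<theta> (s + 4 * t) = \<theta> s"
    and dec: "\<And>s s'. - t \<le> s \<Longrightarrow> s < s' \<Longrightarrow> s' \<le> t \<Longrightarrow> r s' < r s"
    and less: "\<And>s. - t < s \<Longrightarrow> s < t \<Longrightarrow> \<theta> s < pi / 4" and t4: "\<theta> t = pi / 4" "\<theta> (- t) = pi / 4"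
    and eq: "r s = r s'" "\<theta> s = \<theta> s'"
  shows "\<exists>k::int. s' = s + of_int k * (4 * t)"
proof -
  have norm: "\<exists>k::int. - t < x + of_int k * (4 * t) \<and> x + of_int k * (4 * t) \<le> 3 * t" for x
  proof -
    obtain k :: int where k: "\<bar>x + of_int k * (4 * t) - t\<bar> \<le> 4 * t / 2"
      using translate_into_period[of "4 * t" x t] t by auto
    show ?thesis
    proof (cases "x + of_int k * (4 * t) = - t")
      case True
      then show ?thesis using t by (intro exI[of _ "k + 1"]) (simp add: distrib_right)
    next
      case False
      then show ?thesis using k t by (intro exI[of _ k]) (auto simp: abs_le_iff)
    qed
  qed
  obtain k k' :: int where k: "- t < s + of_int k * (4 * t)" "s + of_int k * (4 * t) \<le> 3 * t"
    and k': "- t < s' + of_int k' * (4 * t)" "s' + of_int k' * (4 * t) \<le> 3 * t"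
    using norm by meson
  define x where "x = s + of_int k * (4 * t)"
  define y where "y = s' + of_int k' * (4 * t)"
  have x: "- t < x" "x \<le> 3 * t" and y: "- t < y" "y \<le> 3 * t" using k k' by (simp_all add: x_def y_def)
  have e: "r x = r y" "\<theta> x = \<theta> y"
    unfolding x_def y_def by (simp_all add: periodic_of_int[of r, OF per(1)] periodic_of_int[of \<theta>, OF per(2)] eq)
  have inj: "u = v" if "- t \<le> u" "u \<le> t" "- t \<le> v" "v \<le> t" "r u = r v" for u v
    using dec[of u v] dec[of v u] that by (cases u v rule: linorder_cases) simp_all
  have ge: "\<theta> u \<ge> pi / 4" if "t \<le> u" "u \<le> 3 * t" for u
  proof -
    have "\<theta> (2 * t - u) \<le> pi / 4"
      using less[of "2 * t - u"] t4 that by (cases "2 * t - u = t \<or> 2 * t - u = - t") auto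
    then show ?thesis by (simp add: refl)
  qed
  have "x = y"
  proof (cases "x < t \<longleftrightarrow> y < t")
    case True
    show ?thesis
    proof (cases "x < t")
      case True
      then show ?thesis using \<open>x < t \<longleftrightarrow> y < t\<close> x y e(1) by - (rule inj, simp_all)
    next
      case False
      then have "2 * t - x = 2 * t - y" using True x y e(1) by - (rule inj, simp_all add: refl)
      then show ?thesis by simp
    qed
  next
    case False
    then have "(\<theta> x < pi / 4 \<and> pi / 4 \<le> \<theta> y) \<or> (\<theta> y < pi / 4 \<and> pi / 4 \<le> \<theta> x)"
      using less[of x] less[of y] ge[of x] ge[of y] x y by linarith
    then show ?thesis using e(2) by linarith
  qed
  then have "s' = s + of_int (k - k') * (4 * t)" by (simp add: x_def y_def algebra_simps)
  then show ?thesis by blast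
qed

section \<open>The hypersurface swept out by the profile curve\<close>

text \<open>
  With \<open>sr\<close>, \<open>cr\<close> and so on standing for the sines and cosines of \<open>r\<close>, \<open>\<theta>\<close>, \<open>\<alpha>\<close>, these say that position,
  velocity and normal of the profile curve are orthonormal.
\<close>

lemma profile_frame_identities:
  fixes sr cr st ct sa ca :: real
  assumes "sr * sr + cr * cr = 1" "st * st + ct * ct = 1" "sa * sa + ca * ca = 1"
  defines "x \<equiv> sr * ct" and "y \<equiv> sr * st" and "z \<equiv> cr"
    and "x' \<equiv> cr * ca * ct - sa * st" and "y' \<equiv> cr * ca * st + sa * ct" and "z' \<equiv> - sr * ca"
    and "n1 \<equiv> - sa * cr * ct - ca * st" and "n2 \<equiv> - sa * cr * st + ca * ct" and "n3 \<equiv> sa * sr"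
  shows "x * x + y * y + z * z = 1" "x' * x' + y' * y' + z' * z' = 1" "n1 * n1 + n2 * n2 + n3 * n3 = 1"
    "x * x' + y * y' + z * z' = 0" "x * n1 + y * n2 + z * n3 = 0" "n1 * x' + n2 * y' + n3 * z' = 0"
  unfolding x_def y_def z_def x'_def y'_def z'_def n1_def n2_def n3_def using assms(1-3) by algebra+

text \<open>
  The Frenet equation of a spherical curve: the derivative of the normal is \<open>- \<kappa>\<close> times the velocity,
  with \<open>q\<close> for the derivative of \<open>\<theta>\<close> and \<open>A\<close> for that of \<open>\<alpha>\<close>; the geodesic curvature is \<open>A + cr * q\<close>.
\<close>

lemma normal_derivative_identities:
  fixes sr cr st ct sa ca q A :: real
  assumes "sr * sr + cr * cr = 1" "sa = sr * q"
  shows "- (ca * A * cr * ct) + sa * (sr * ca) * ct + sa * cr * (st * q) + sa * A * st - ca * (ct * q)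
      = - (A + cr * q) * (cr * ca * ct - sa * st)"
    "- (ca * A * cr * st) + sa * (sr * ca) * st - sa * cr * (ct * q) - sa * A * ct - ca * (st * q)
      = - (A + cr * q) * (cr * ca * st + sa * ct)"
    "ca * A * sr + sa * (cr * ca) = - (A + cr * q) * (- sr * ca)"
  using assms by algebra+

text \<open>
  The circle directions contribute \<open>- 2 * cot (2 * \<phi>) * cos \<psi> / sin \<rho>\<close>, by way of
  \<open>cot \<phi> - tan \<phi> = 2 * cot (2 * \<phi>)\<close>, and \<open>2 * cot \<rho> * sin \<psi>\<close>; the geodesic curvature adds one more
  \<open>cot \<rho> * sin \<psi>\<close>. Together they cancel every term of \<open>turning\<close> except \<open>- 3\<close>.
\<close>

lemma profile_mean_curvature:
  assumes "sin \<rho> \<noteq> 0" "sin \<phi> \<noteq> 0" "cos \<phi> \<noteq> 0"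
  shows "turning \<rho> \<phi> \<psi> + cos \<rho> * (sin \<psi> / sin \<rho>)
     - (- sin \<psi> * cos \<rho> * cos \<phi> - cos \<psi> * sin \<phi>) / (sin \<rho> * cos \<phi>)
     - (- sin \<psi> * cos \<rho> * sin \<phi> + cos \<psi> * cos \<phi>) / (sin \<rho> * sin \<phi>) = - 3"
  using assms unfolding turning_def cot_def sin_double cos_double
  by (simp add: field_simps power2_eq_square)

theorem corollary1p2:
  fixes a t :: real and J :: "real set" and r \<theta> \<alpha> :: "real \<Rightarrow> real" and M :: "R5 set"
  assumes "a \<in> {5204/10000<..<5244/10000}"
    and "t \<in> {3966/10000<..<3991/10000}"
    and "maximal_profile_solution a J r \<theta> \<alpha>"
    and "{0..3991/10000} \<subseteq> J"
    and "\<alpha> t = pi / 2"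
    and "\<theta> t = pi / 4"
    and "M = {((sin (r s) * cos (\<theta> s)) *\<^sub>R y, (sin (r s) * sin (\<theta> s)) *\<^sub>R z, cos (r s)) | s y z.
               s \<in> {0..4 * t} \<and> y \<in> sphere 0 1 \<and> z \<in> sphere 0 1}"
  shows "{0..4 * t} \<subseteq> J \<and> embedded_hypersurface M \<and>
         (\<exists>N. unit_normal_field M N \<and> (\<forall>p\<in>M. mean_curvature M N p = -3))"
proof -
  have t: "0 < t" "t < 3991 / 10000" using assms(2) by auto
  have a: "52 / 100 < a" "a < 525 / 1000" using assms(1) by auto
  have tJ: "t \<in> J" using t assms(4) by auto
  have init: "r 0 = pi / 2" "\<theta> 0 = a" "\<alpha> 0 = pi"
    using assms(3) unfolding maximal_profile_solution_def profile_solution_iff by blast+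
  note sym = maximal_profile_solution_symmetric[OF assms(3) t(1) tJ assms(5,6)]
  note flow = sym(2)
  note D = profile_flow_UNIV_D[OF flow] and smooth = profile_flow_smooth[OF flow]
  have cont: "continuous_on UNIV r" "continuous_on UNIV \<theta>"
    using D by (auto intro!: continuous_at_imp_continuous_on DERIV_isCont)
  have per: "r (s + 4 * t) = r s" "\<theta> (s + 4 * t) = \<theta> s" "\<alpha> (s + 4 * t) = \<alpha> s - 2 * pi" for s
  proof -
    \<comment> \<open>the translation by \<open>4 * t\<close> as the square of the composition of the two reflections\<close>
    have e: "2 * t - (s + 4 * t) = - (2 * t - (- s))" by simp
    show "r (s + 4 * t) = r s" "\<theta> (s + 4 * t) = \<theta> s" "\<alpha> (s + 4 * t) = \<alpha> s - 2 * pi"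
      using sym(6-8)[of "s + 4 * t"] unfolding e sym(3-5) sym(6-8) by simp_all
  qed
  have r: "0 < r s" "r s < pi" for s
  proof -
    have "r x \<noteq> 0" "r x \<noteq> pi" for x using profile_flowD(1)[OF flow, of x] by auto
    then show "0 < r s" "r s < pi"
      using in_open_interval_if_avoids_ends[OF cont(1), of 0 pi s] init by auto
  qed
  have \<theta>: "0 < \<theta> s" "\<theta> s < pi / 2" for s
  proof -
    have "2 * \<theta> x \<noteq> 0" "2 * \<theta> x \<noteq> pi" for x using profile_flowD(2)[OF flow, of x] by (metis UNIV_I sin_zero sin_pi)+
    then have "\<theta> x \<noteq> 0" "\<theta> x \<noteq> pi / 2" for x by (auto simp: field_simps)
    then show "0 < \<theta> s" "\<theta> s < pi / 2"
      using in_open_interval_if_avoids_ends[OF cont(2), of 0 "pi / 2" s] init a pi_gt3 by auto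
  qed
  have pos: "sin (r s) > 0" "sin (\<theta> s) > 0" "cos (\<theta> s) > 0" for s
    using r[of s] \<theta>[of s] by (auto intro: sin_gt_zero cos_gt_zero)
  have dec: "\<alpha> s' < \<alpha> s" if "0 \<le> s" "s < s'" "s' \<le> t" for s s'
    by (rule \<alpha>_strict_decreasing[OF flow init a, of t]) (use t that in auto)
  have \<alpha>1: "pi / 2 < \<alpha> s \<and> \<alpha> s \<le> pi" if "0 \<le> s" "s < t" for s
    using dec[of s t] dec[of 0 s] that init assms(5) by (cases "s = 0") auto
  have r_dec: "r s' < r s" if s: "- t \<le> s" "s < s'" "s' \<le> t" for s s'
  proof (rule DERIV_neg_imp_decreasing_open[OF s(2)])
    fix x assume x: "s < x" "x < s'"
    have "pi / 2 < \<alpha> x \<and> \<alpha> x < 3 * pi / 2"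
    proof (cases "0 \<le> x")
      case True
      then show ?thesis using \<alpha>1[of x] x s pi_gt_zero by auto
    next
      case False
      then show ?thesis using \<alpha>1[of "- x"] sym(5)[of x] x s pi_gt_zero by auto
    qed
    then have "cos (\<alpha> x - pi) > 0" by (intro cos_gt_zero_pi) auto
    then have "cos (\<alpha> x) < 0" by (simp add: cos_diff)
    then show "\<exists>y. (r has_real_derivative y) (at x) \<and> y < 0" using D(1) by blast
  qed (rule continuous_on_subset[OF cont(1) subset_UNIV])
  have \<theta>_pos: "\<theta> s < pi / 4" if s: "0 \<le> s" "s < t" for s
  proof -
    have "\<theta> s < \<theta> t"
    proof (rule DERIV_pos_imp_increasing_open[OF s(2)])
      fix x assume x: "s < x" "x < t"
      have "0 < \<alpha> x" "\<alpha> x < pi" using \<alpha>1[of x] dec[of 0 x] x s init pi_gt_zero by auto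
      then have "sin (\<alpha> x) / sin (r x) > 0" using pos by (simp add: sin_gt_zero)
      then show "\<exists>y. (\<theta> has_real_derivative y) (at x) \<and> 0 < y" using D(2) by blast
    qed (rule continuous_on_subset[OF cont(2) subset_UNIV])
    then show ?thesis by (simp add: assms(6))
  qed
  have \<theta>_less: "\<theta> s < pi / 4" if "- t < s" "s < t" for s
    using \<theta>_pos[of s] \<theta>_pos[of "- s"] sym(4)[of s] that by (cases "0 \<le> s") auto
  interpret C: profile_curve "\<lambda>s. sin (r s) * cos (\<theta> s)" "\<lambda>s. sin (r s) * sin (\<theta> s)" "\<lambda>s. cos (r s)"
    "\<lambda>s. cos (r s) * cos (\<alpha> s) * cos (\<theta> s) - sin (\<alpha> s) * sin (\<theta> s)"
    "\<lambda>s. cos (r s) * cos (\<alpha> s) * sin (\<theta> s) + sin (\<alpha> s) * cos (\<theta> s)"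
    "\<lambda>s. - sin (r s) * cos (\<alpha> s)"
    "\<lambda>s. - sin (\<alpha> s) * cos (r s) * cos (\<theta> s) - cos (\<alpha> s) * sin (\<theta> s)"
    "\<lambda>s. - sin (\<alpha> s) * cos (r s) * sin (\<theta> s) + cos (\<alpha> s) * cos (\<theta> s)"
    "\<lambda>s. sin (\<alpha> s) * sin (r s)"
    "\<lambda>s. turning (r s) (\<theta> s) (\<alpha> s) + cos (r s) * (sin (\<alpha> s) / sin (r s))" "4 * t"
  proof
    fix s s'
    have sm: "smooth_on UNIV (\<lambda>s. sin (f s))" "smooth_on UNIV (\<lambda>s. cos (f s))" "smooth_on UNIV (\<lambda>s. - sin (f s))"
      if "smooth_on UNIV f" for f :: "real \<Rightarrow> real"
    proof -
      show "smooth_on UNIV (\<lambda>s. sin (f s))" "smooth_on UNIV (\<lambda>s. cos (f s))"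
        by (rule smooth_on_sin[OF open_UNIV that] smooth_on_cos[OF open_UNIV that])+
      show "smooth_on UNIV (\<lambda>s. - sin (f s))"
        using smooth_on_mult[OF open_UNIV smooth_on_const[of _ "- 1"] smooth_on_sin[OF open_UNIV that]] by simp
    qed
    have diff: "smooth_on UNIV (\<lambda>s. f s - g s)" if "smooth_on UNIV f" "smooth_on UNIV g" for f g :: "real \<Rightarrow> real"
      using smooth_on_add[OF open_UNIV that(1) smooth_on_mult[OF open_UNIV smooth_on_const[of _ "- 1"] that(2)]] by simp
    show "smooth_on UNIV (\<lambda>s. sin (r s) * cos (\<theta> s))" "smooth_on UNIV (\<lambda>s. sin (r s) * sin (\<theta> s))"
      "smooth_on UNIV (\<lambda>s. cos (r s))"
      "smooth_on UNIV (\<lambda>s. - sin (\<alpha> s) * cos (r s) * cos (\<theta> s) - cos (\<alpha> s) * sin (\<theta> s))"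
      "smooth_on UNIV (\<lambda>s. - sin (\<alpha> s) * cos (r s) * sin (\<theta> s) + cos (\<alpha> s) * cos (\<theta> s))"
      "smooth_on UNIV (\<lambda>s. sin (\<alpha> s) * sin (r s))"
      by (intro smooth_on_mult smooth_on_add diff sm smooth open_UNIV)+
    \<comment> \<open>\<open>q\<close> is the derivative of \<open>\<theta>\<close>; with it all remaining identities are polynomial\<close>
    define q where "q = sin (\<alpha> s) / sin (r s)"
    have q: "sin (\<alpha> s) = sin (r s) * q" using pos[of s] by (simp add: q_def)
    note D' = D(1)[of s] D(2)[of s, folded q_def] D(3)[of s]
    have sq: "sin x * sin x + cos x * cos x = 1" for x :: real
      using sin_cos_squared_add[of x] by (simp add: power2_eq_square)
    show "((\<lambda>s. sin (r s) * cos (\<theta> s)) has_real_derivative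
        cos (r s) * cos (\<alpha> s) * cos (\<theta> s) - sin (\<alpha> s) * sin (\<theta> s)) (at s)"
      by (auto intro!: derivative_eq_intros D' simp: q)
    show "((\<lambda>s. sin (r s) * sin (\<theta> s)) has_real_derivative
        cos (r s) * cos (\<alpha> s) * sin (\<theta> s) + sin (\<alpha> s) * cos (\<theta> s)) (at s)"
      by (auto intro!: derivative_eq_intros D' simp: q)
    show "((\<lambda>s. cos (r s)) has_real_derivative - sin (r s) * cos (\<alpha> s)) (at s)"
      by (auto intro!: derivative_eq_intros D')
    note I = normal_derivative_identities[OF sq[of "r s"] q, folded q_def]
    show "((\<lambda>s. - sin (\<alpha> s) * cos (r s) * cos (\<theta> s) - cos (\<alpha> s) * sin (\<theta> s)) has_real_derivative
        - (turning (r s) (\<theta> s) (\<alpha> s) + cos (r s) * (sin (\<alpha> s) / sin (r s))) *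
          (cos (r s) * cos (\<alpha> s) * cos (\<theta> s) - sin (\<alpha> s) * sin (\<theta> s))) (at s)"
      unfolding q_def[symmetric] I(1)[symmetric]
      by (auto intro!: derivative_eq_intros D' simp: algebra_simps)
    show "((\<lambda>s. - sin (\<alpha> s) * cos (r s) * sin (\<theta> s) + cos (\<alpha> s) * cos (\<theta> s)) has_real_derivative
        - (turning (r s) (\<theta> s) (\<alpha> s) + cos (r s) * (sin (\<alpha> s) / sin (r s))) *
          (cos (r s) * cos (\<alpha> s) * sin (\<theta> s) + sin (\<alpha> s) * cos (\<theta> s))) (at s)"
      unfolding q_def[symmetric] I(2)[symmetric]
      by (auto intro!: derivative_eq_intros D' simp: algebra_simps)
    show "((\<lambda>s. sin (\<alpha> s) * sin (r s)) has_real_derivative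
        - (turning (r s) (\<theta> s) (\<alpha> s) + cos (r s) * (sin (\<alpha> s) / sin (r s))) * (- sin (r s) * cos (\<alpha> s))) (at s)"
      unfolding q_def[symmetric] I(3)[symmetric]
      by (auto intro!: derivative_eq_intros D' simp: algebra_simps)
    show "sin (r s) * cos (\<theta> s) > 0" "sin (r s) * sin (\<theta> s) > 0" using pos by simp_all
    note F = profile_frame_identities[OF sq[of "r s"] sq[of "\<theta> s"] sq[of "\<alpha> s"]]
    show "sin (r s) * cos (\<theta> s) * (sin (r s) * cos (\<theta> s)) + sin (r s) * sin (\<theta> s) * (sin (r s) * sin (\<theta> s)) + cos (r s) * cos (r s) = 1"
      by (rule F(1))
    show "(cos (r s) * cos (\<alpha> s) * cos (\<theta> s) - sin (\<alpha> s) * sin (\<theta> s)) * (cos (r s) * cos (\<alpha> s) * cos (\<theta> s) - sin (\<alpha> s) * sin (\<theta> s))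
      + (cos (r s) * cos (\<alpha> s) * sin (\<theta> s) + sin (\<alpha> s) * cos (\<theta> s)) * (cos (r s) * cos (\<alpha> s) * sin (\<theta> s) + sin (\<alpha> s) * cos (\<theta> s))
      + - sin (r s) * cos (\<alpha> s) * (- sin (r s) * cos (\<alpha> s)) = 1"
      by (rule F(2))
    show "(- sin (\<alpha> s) * cos (r s) * cos (\<theta> s) - cos (\<alpha> s) * sin (\<theta> s)) * (- sin (\<alpha> s) * cos (r s) * cos (\<theta> s) - cos (\<alpha> s) * sin (\<theta> s))
      + (- sin (\<alpha> s) * cos (r s) * sin (\<theta> s) + cos (\<alpha> s) * cos (\<theta> s)) * (- sin (\<alpha> s) * cos (r s) * sin (\<theta> s) + cos (\<alpha> s) * cos (\<theta> s))
      + sin (\<alpha> s) * sin (r s) * (sin (\<alpha> s) * sin (r s)) = 1"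
      by (rule F(3))
    show "sin (r s) * cos (\<theta> s) * (cos (r s) * cos (\<alpha> s) * cos (\<theta> s) - sin (\<alpha> s) * sin (\<theta> s))
      + sin (r s) * sin (\<theta> s) * (cos (r s) * cos (\<alpha> s) * sin (\<theta> s) + sin (\<alpha> s) * cos (\<theta> s))
      + cos (r s) * (- sin (r s) * cos (\<alpha> s)) = 0"
      by (rule F(4))
    show "sin (r s) * cos (\<theta> s) * (- sin (\<alpha> s) * cos (r s) * cos (\<theta> s) - cos (\<alpha> s) * sin (\<theta> s))
      + sin (r s) * sin (\<theta> s) * (- sin (\<alpha> s) * cos (r s) * sin (\<theta> s) + cos (\<alpha> s) * cos (\<theta> s))
      + cos (r s) * (sin (\<alpha> s) * sin (r s)) = 0"
      by (rule F(5))
    show "(- sin (\<alpha> s) * cos (r s) * cos (\<theta> s) - cos (\<alpha> s) * sin (\<theta> s)) * (cos (r s) * cos (\<alpha> s) * cos (\<theta> s) - sin (\<alpha> s) * sin (\<theta> s))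
      + (- sin (\<alpha> s) * cos (r s) * sin (\<theta> s) + cos (\<alpha> s) * cos (\<theta> s)) * (cos (r s) * cos (\<alpha> s) * sin (\<theta> s) + sin (\<alpha> s) * cos (\<theta> s))
      + sin (\<alpha> s) * sin (r s) * (- sin (r s) * cos (\<alpha> s)) = 0"
      by (rule F(6))
    show "4 * t > 0" using t by simp
    have m: "sin (\<alpha> s - 2 * pi) = sin (\<alpha> s)" "cos (\<alpha> s - 2 * pi) = cos (\<alpha> s)"
      by (simp_all add: sin_diff cos_diff)
    show "sin (r (s + 4 * t)) * cos (\<theta> (s + 4 * t)) = sin (r s) * cos (\<theta> s)"
      "sin (r (s + 4 * t)) * sin (\<theta> (s + 4 * t)) = sin (r s) * sin (\<theta> s)" "cos (r (s + 4 * t)) = cos (r s)"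
      "- sin (\<alpha> (s + 4 * t)) * cos (r (s + 4 * t)) * cos (\<theta> (s + 4 * t)) - cos (\<alpha> (s + 4 * t)) * sin (\<theta> (s + 4 * t))
        = - sin (\<alpha> s) * cos (r s) * cos (\<theta> s) - cos (\<alpha> s) * sin (\<theta> s)"
      "- sin (\<alpha> (s + 4 * t)) * cos (r (s + 4 * t)) * sin (\<theta> (s + 4 * t)) + cos (\<alpha> (s + 4 * t)) * cos (\<theta> (s + 4 * t))
        = - sin (\<alpha> s) * cos (r s) * sin (\<theta> s) + cos (\<alpha> s) * cos (\<theta> s)"
      "sin (\<alpha> (s + 4 * t)) * sin (r (s + 4 * t)) = sin (\<alpha> s) * sin (r s)"
      by (simp_all only: per m)
    assume eq: "sin (r s) * cos (\<theta> s) = sin (r s') * cos (\<theta> s')" "sin (r s) * sin (\<theta> s) = sin (r s') * sin (\<theta> s')"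
      "cos (r s) = cos (r s')"
    have r_eq: "r s = r s'" using eq(3) r[of s] r[of s'] by - (rule cos_inj_pi, simp_all)
    moreover have "\<theta> s = \<theta> s'"
      using eq(1) r_eq pos(1)[of s'] \<theta>[of s] \<theta>[of s'] by - (rule cos_inj_pi, simp_all)
    ultimately show "\<exists>k::int. s' = s + of_int k * (4 * t)"
      by - (rule profile_curve_simple[OF t(1) sym(6,7) per(1,2) r_dec \<theta>_less assms(6)], simp_all add: assms(6) sym(4))
  qed
  have MC: "M = C.hypersurface"
  proof (intro equalityI subsetI)
    fix p assume "p \<in> M"
    then obtain s u v where "p = C.orbit_pt s u v"
      unfolding assms(7) sphere_eq_range_circle_pt C.orbit_pt_def torus_vec_def by auto
    then show "p \<in> C.hypersurface" by (simp add: C.orbit_pt_in_hypersurface)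
  next
    fix p assume "p \<in> C.hypersurface"
    then obtain s u v where p: "p = C.orbit_pt s u v" by (rule C.hypersurfaceE)
    obtain k :: int where k: "\<bar>s + of_int k * (4 * t) - 2 * t\<bar> \<le> 4 * t / 2"
      using translate_into_period[of "4 * t" s "2 * t"] t by auto
    define s' where "s' = s + of_int k * (4 * t)"
    have "p = C.orbit_pt s' u v"
      unfolding p C.orbit_pt_eq_iff s'_def by (intro conjI exI[of _ k] exI[of _ 0]) simp_all
    moreover have "s' \<in> {0..4 * t}" using k by (auto simp: s'_def abs_le_iff)
    ultimately show "p \<in> M"
      unfolding assms(7) sphere_eq_range_circle_pt C.orbit_pt_def torus_vec_def by blast
  qed
  have "mean_curvature C.hypersurface C.normal p = - 3" if "p \<in> C.hypersurface" for p
  proof -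
    obtain s u v where p: "p = C.orbit_pt s u v" using \<open>p \<in> C.hypersurface\<close> by (rule C.hypersurfaceE)
    show ?thesis unfolding p C.mean_curvature_hypersurface
      using profile_mean_curvature pos[of s] by (metis less_irrefl)
  qed
  then show ?thesis
    unfolding MC using sym(1) C.embedded C.unit_normal by blast
qed

end
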